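(* For every complex number $q$ with $0<|q|<1$, the following three chains of identities hold: \begin{align*} \sum_{n=0}^\infty \frac{(q;q^2)_nq^n}{(q^2;q^2)_n}&= \frac{(q;q^2)_{\infty}}{(q^2;q^2)_{\infty}}\sum_{n=0}^\infty\sum_{|m|\leq n}(-1)^{n+m}q^{n^2+n-m^2}= \frac{(q;q^2)_{\infty}}{(q^2;q^2)_{\infty}}f_{0,1,0}(-q,-q;q^4)=\frac{J_2^2}{J_1}; \end{align*} \begin{align*} \sum_{n=0}^\infty \frac{(-1)^nq^{n^2+n}}{(q^2;q^2)_n}&=\frac{1}{(q;q)_{\infty}}\sum_{n=0}^{\infty}\sum_{|m|\leq n} (-1)^{m}(1-q^{2n+1})q^{2n^2+n-m^2}\\ &=\frac{1}{(q;q)_{\infty}}\left(f_{1,3,1}(q^2,q^2;q^2) + q^3f_{1,3,1}(q^6,q^6;q^2)\right)=\frac{J_1J_2}{(q;q)_{\infty}}=J_2; \end{align*} \begin{align*} \sum_{n=0}^\infty \frac{(-1)^nq^{n(n+1)/2}}{(q;q)_n}&=\frac{(-q;q)_\infty}{(q;q)_{\infty}}\sum_{n=0}^{\infty}\sum_{|m|\leq n} (-1)^{m}(1-q^{2n+1})q^{(3n^2+n)/2-m^2}\\ &= \frac{(-q;q)_\infty}{(q;q)_{\infty}}\left(f_{1,5,1}(q,q;q)+q^2f_{1,5,1}(q^4,q^4;q)\right)=\frac{(-q;q)_\infty}{(q;q)_{\infty}}J_1J_{1,2}=J_1. \end{align*}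
   Context: Notation: $(x;q)_n:=\prod_{i=0}^{n-1}(1-q^ix)$, $(x;q)_\infty:=\prod_{i=0}^{\infty}(1-q^ix)$. Theta functions: $j(x;q):=(x;q)_\infty(q/x;q)_\infty(q;q)_\infty=\sum_{n\in\mathbb{Z}}(-1)^nq^{\binom n2}x^n$ for $x\neq0$; $J_{a,m}:=j(q^a;q^m)$; $J_m:=J_{m,3m}=\prod_{i=1}^\infty(1-q^{mi})$. Type I double-sum: $$f_{a,b,c}(x,y;q):=\Big(\sum_{r,s\ge 0}-\sum_{r,s<0}\Big)(-1)^{r+s}x^ry^sq^{a\binom r2+brs+c\binom s2},$$ where $r,s$ run over integers, the first sum is over pairs with both $r,s\ge0$ and the second over pairs with both $r,s<0$, and $\binom{r}{2}=r(r-1)/2$ for all integers $r$. *)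

theory Defs
  imports "HOL-Analysis.Analysis"
begin

definition qpoch :: "complex \<Rightarrow> complex \<Rightarrow> nat \<Rightarrow> complex" where
  "qpoch x q n = (\<Prod>i<n. 1 - q ^ i * x)"

definition qpoch_inf :: "complex \<Rightarrow> complex \<Rightarrow> complex" where
  "qpoch_inf x q = (\<Prod>i. 1 - q ^ i * x)"

definition theta_j :: "complex \<Rightarrow> complex \<Rightarrow> complex" where
  "theta_j x q = qpoch_inf x q * qpoch_inf (q / x) q * qpoch_inf q q"

text \<open>\<open>theta_J a m q\<close> and \<open>eta_J m q\<close> are the theta constants usually written
  \<open>J\<^bsub>a,m\<^esub>\<close> and \<open>J\<^bsub>m\<^esub>\<close>, with the nome \<open>q\<close> made explicit.\<close>

definition theta_J :: "nat \<Rightarrow> nat \<Rightarrow> complex \<Rightarrow> complex" where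
  "theta_J a m q = theta_j (q ^ a) (q ^ m)"

definition eta_J :: "nat \<Rightarrow> complex \<Rightarrow> complex" where
  "eta_J m q = theta_J m (3 * m) q"

text \<open>\<open>dsum_f a b c x y q\<close> is the Hecke-type double sum
  \<open>f\<^bsub>a,b,c\<^esub>(x, y; q)\<close>. The integer divisions are exact, since \<open>r * (r - 1)\<close> is always even;
  \<open>r * (r - 1) div 2\<close> is the binomial coefficient "r over 2", also for negative \<open>r\<close>.\<close>

definition dsum_term ::
    "int \<Rightarrow> int \<Rightarrow> int \<Rightarrow> complex \<Rightarrow> complex \<Rightarrow> complex \<Rightarrow> int \<times> int \<Rightarrow> complex" where
  "dsum_term a b c x y q = (\<lambda>(r, s).
     (-1) powi (r + s) * x powi r * y powi s *
     q powi (a * (r * (r - 1) div 2) + b * r * s + c * (s * (s - 1) div 2)))"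

definition dsum_f ::
    "int \<Rightarrow> int \<Rightarrow> int \<Rightarrow> complex \<Rightarrow> complex \<Rightarrow> complex \<Rightarrow> complex" where
  "dsum_f a b c x y q =
     (\<Sum>\<^sub>\<infinity>p\<in>{0..} \<times> {0..}. dsum_term a b c x y q p) -
     (\<Sum>\<^sub>\<infinity>p\<in>{..<0} \<times> {..<0}. dsum_term a b c x y q p)"

text \<open>An \<open>infsum\<close> that does not converge is 0, so convergence of the double sum is a
  separate condition.\<close>

definition dsum_converges ::
    "int \<Rightarrow> int \<Rightarrow> int \<Rightarrow> complex \<Rightarrow> complex \<Rightarrow> complex \<Rightarrow> bool" where
  "dsum_converges a b c x y q \<longleftrightarrow>
     dsum_term a b c x y q summable_on ({0..} \<times> {0..}) \<and>
     dsum_term a b c x y q summable_on ({..<0} \<times> {..<0})"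

end

theory Submission
  imports Defs
begin

text \<open>All three identities come from one Bailey pair relative to \<open>a = q\<close>, namely
  \<open>\<beta>\<^sub>n = (-1)\<^sup>n / (q\<^sup>2; q\<^sup>2)\<^sub>n\<close> and \<open>\<alpha>\<^sub>r = q\<^bsup>r\<^sup>2\<^esup> (1 - q\<^bsup>2r+1\<^esup>) / (1 - q) \<Sum>\<^bsub>|m| \<le> r\<^esub> (-1)\<^sup>m q\<^bsup>-m\<^sup>2\<^esup>\<close>.
  The pair holds because the sum over \<open>r\<close> telescopes and leaves the alternating sum of the Gaussian
  binomials \<open>[2n, j]\<close>. Bailey's lemma, which is the q-Gauss sum after an interchange of
  summation, is applied with \<open>(\<rho>\<^sub>1, \<rho>\<^sub>2)\<close> equal to \<open>(\<surd>q, -\<surd>q)\<close>, \<open>(\<infinity>, \<infinity>)\<close> and \<open>(\<infinity>, -q)\<close>.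
  The single sums are evaluated by the q-binomial theorem, again a case of the q-Gauss sum, and the
  sums over \<open>|m| \<le> n\<close> turn into \<open>f\<^bsub>a,b,c\<^esub>\<close> by splitting according to the parity of \<open>n + m\<close>:
  \<open>(n, m) = (r + s, r - s)\<close> or \<open>(n, m) = (r + s + 1, r - s)\<close>.\<close>

subsection \<open>The q-Pochhammer symbol\<close>

lemma qpoch_0 [simp]: "qpoch x q 0 = 1"
  by (simp add: qpoch_def)

lemma qpoch_Suc: "qpoch x q (Suc n) = qpoch x q n * (1 - q ^ n * x)"
  by (simp add: qpoch_def)

lemma qpoch_add: "qpoch x q (m + n) = qpoch x q m * qpoch (q ^ m * x) q n"
  by (induction n) (simp_all add: qpoch_Suc power_add algebra_simps)

lemma qpoch_mult_minus: "qpoch x q n * qpoch (- x) q n = qpoch (x ^ 2) (q ^ 2) n"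
  by (induction n) (simp_all add: qpoch_Suc algebra_simps power2_eq_square power_mult_distrib)

text \<open>The factors are sorted by the residue of their index modulo \<open>m\<close>.\<close>

lemma qpoch_dissect: "qpoch x q (m * n) = (\<Prod>j<m. qpoch (q ^ j * x) (q ^ m) n)"
proof (induction n)
  case (Suc n)
  have "qpoch x q (m * Suc n) = qpoch x q (m * n + m)"
    by (simp add: add.commute)
  also have "\<dots> = qpoch x q (m * n) * qpoch (q ^ (m * n) * x) q m"
    by (rule qpoch_add)
  also have "\<dots> = (\<Prod>j<m. qpoch (q ^ j * x) (q ^ m) n) * (\<Prod>j<m. 1 - (q ^ m) ^ n * (q ^ j * x))"
    unfolding Suc by (simp add: qpoch_def power_mult mult_ac)
  finally show ?case
    by (simp add: qpoch_Suc prod.distrib)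
qed simp

lemma qpoch_nonzero:
  assumes "\<And>i. q ^ i * x \<noteq> 1"
  shows "qpoch x q n \<noteq> 0"
  proof
  assume "qpoch x q n = 0"
  then obtain i where "1 - q ^ i * x = 0"
    by (auto simp: qpoch_def)
  with assms[of i] show False by simp
qed

lemma power_neq_one:
  fixes q :: complex
  assumes "norm q < 1" "n > 0"
  shows "q ^ n \<noteq> 1"
proof
  assume "q ^ n = 1"
  then have "norm q ^ n = 1"
    by (metis norm_one norm_power)
  with power_Suc_less_one[of "norm q" "n - 1"] assms show False
    by (cases "q = 0") (auto simp: power_0_left)
qed

lemma power_mult_neq_one:
  fixes q x :: complex
  assumes "norm q < 1" "norm x < 1"
  shows "q ^ n * x \<noteq> 1"
proof
  assume "q ^ n * x = 1"
  then have "norm q ^ n * norm x = 1"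
    by (metis norm_one norm_mult norm_power)
  moreover have "norm q ^ n * norm x \<le> 1 * norm x"
    using assms by (intro mult_right_mono power_le_one) auto
  ultimately show False
    using assms by simp
qed

section \<open>Infinite products as limits of finite ones\<close>

context
  fixes q :: complex
  assumes q: "norm q < 1"
begin

lemma convergent_prod_qpoch: "convergent_prod (\<lambda>i. 1 - q ^ i * x)"
proof -
  have "summable (\<lambda>i. norm ((1 - q ^ i * x) - 1))"
    using q by (auto simp: norm_mult norm_power intro!: summable_mult2 summable_geometric)
  then show ?thesis
    by (intro abs_convergent_prod_imp_convergent_prod)
       (simp add: abs_convergent_prod_conv_summable)
qed

lemma qpoch_tendsto: "qpoch x q \<longlonglongrightarrow> qpoch_inf x q"
proof -
  have "(\<lambda>n. \<Prod>i\<le>n. 1 - q ^ i * x) \<longlonglongrightarrow> qpoch_inf x q"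
    unfolding qpoch_inf_def by (rule convergent_prod_LIMSEQ[OF convergent_prod_qpoch])
  then have "(\<lambda>n. qpoch x q (Suc n)) \<longlonglongrightarrow> qpoch_inf x q"
    by (simp add: qpoch_def lessThan_Suc_atMost)
  then show ?thesis
    by (rule LIMSEQ_imp_Suc)
qed

lemma qpoch_inf_nonzero:
  assumes "\<And>i. q ^ i * x \<noteq> 1"
  shows "qpoch_inf x q \<noteq> 0"
  unfolding qpoch_inf_def
  by (rule prodinf_nonzero[OF convergent_prod_qpoch]) (metis assms right_minus_eq)

lemma qpoch_inf_zero [simp]: "qpoch_inf 0 q = 1"
  by (simp add: qpoch_inf_def)

lemma qpoch_inf_shift: "qpoch_inf x q = qpoch x q n * qpoch_inf (q ^ n * x) q"
proof (rule LIMSEQ_unique)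
  show "(\<lambda>k. qpoch x q (k + n)) \<longlonglongrightarrow> qpoch_inf x q"
    by (rule LIMSEQ_ignore_initial_segment[OF qpoch_tendsto])
  show "(\<lambda>k. qpoch x q (k + n)) \<longlonglongrightarrow> qpoch x q n * qpoch_inf (q ^ n * x) q"
    unfolding add.commute[of _ n] qpoch_add by (intro tendsto_intros qpoch_tendsto)
qed

lemma Bseq_qpoch: "Bseq (qpoch x q)"
  by (rule convergent_imp_Bseq) (rule convergentI[OF qpoch_tendsto])

text \<open>A nonzero limit keeps the inverses bounded. Such uniform bounds enter the dominating
  estimates in \<open>qgauss_tendsto_one\<close> and \<open>bailey_transform\<close>.\<close>

lemma Bseq_inverse_qpoch:
  assumes "\<And>i. q ^ i * x \<noteq> 1"
  shows "Bseq (\<lambda>n. inverse (qpoch x q n))"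
  by (rule Bfun_inverse[OF qpoch_tendsto qpoch_inf_nonzero[OF assms]])

end

lemma qpoch_inf_mult_minus:
  assumes "norm q < 1"
  shows "qpoch_inf x q * qpoch_inf (- x) q = qpoch_inf (x ^ 2) (q ^ 2)"
proof (rule LIMSEQ_unique)
  have q2: "norm (q ^ 2) < 1"
    using assms by (simp add: norm_power power_less_one_iff)
  show "(\<lambda>n. qpoch x q n * qpoch (- x) q n) \<longlonglongrightarrow> qpoch_inf x q * qpoch_inf (- x) q"
    by (intro tendsto_intros qpoch_tendsto assms)
  show "(\<lambda>n. qpoch x q n * qpoch (- x) q n) \<longlonglongrightarrow> qpoch_inf (x ^ 2) (q ^ 2)"
    unfolding qpoch_mult_minus by (rule qpoch_tendsto[OF q2])
qed

lemma qpoch_inf_dissect: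
  assumes "norm q < 1" "m > 0"
  shows "qpoch_inf x q = (\<Prod>j<m. qpoch_inf (q ^ j * x) (q ^ m))"
proof (rule LIMSEQ_unique)
  have qm: "norm (q ^ m) < 1"
    using assms by (simp add: norm_power power_less_one_iff)
  show "(\<lambda>n. qpoch x q (m * n)) \<longlonglongrightarrow> qpoch_inf x q"
    using LIMSEQ_subseq_LIMSEQ[OF qpoch_tendsto[OF assms(1)], of "\<lambda>n. m * n" x] assms(2)
    by (simp add: strict_mono_def o_def)
  show "(\<lambda>n. qpoch x q (m * n)) \<longlonglongrightarrow> (\<Prod>j<m. qpoch_inf (q ^ j * x) (q ^ m))"
    unfolding qpoch_dissect by (intro tendsto_intros qpoch_tendsto[OF qm])
qed

subsection \<open>The q-Gauss sum\<close>

text \<open>The summand \<open>(a; q)\<^sub>n (b; q)\<^sub>n / ((c; q)\<^sub>n (q; q)\<^sub>n) (c / (a b))\<^sup>n\<close> with \<open>A = 1 / a\<close> and \<open>z = c / b\<close>.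
  In these parameters the limits \<open>a, b \<rightarrow> \<infinity>\<close> are the values \<open>A = 0\<close>, \<open>z = 0\<close>, and
  \<open>c = 0\<close> gives the q-binomial theorem.\<close>

definition qgauss_term :: "complex \<Rightarrow> complex \<Rightarrow> complex \<Rightarrow> complex \<Rightarrow> nat \<Rightarrow> complex" where
  "qgauss_term A z c q n =
     (\<Prod>i<n. (A - q ^ i) * (z - c * q ^ i) / ((1 - c * q ^ i) * (1 - q ^ Suc i)))"

lemma qgauss_term_Suc:
  "qgauss_term A z c q (Suc n) = qgauss_term A z c q n *
     ((A - q ^ n) * (z - c * q ^ n) / ((1 - c * q ^ n) * (1 - q ^ Suc n)))"
  by (simp add: qgauss_term_def)

text \<open>The ratio of consecutive terms tends to \<open>z * A\<close>, since everything else in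
  it carries a power \<open>q ^ n\<close>.\<close>

lemma summable_norm_qgauss_term:
  assumes q: "norm q < 1" and zA: "norm (z * A) < 1"
  shows "summable (\<lambda>n. norm (qgauss_term A z c q n))"
proof -
  define r where "r n = (A - q ^ n) * (z - c * q ^ n) / ((1 - c * q ^ n) * (1 - q ^ Suc n))" for n
  have "r \<longlonglongrightarrow> (A - 0) * (z - c * 0) / ((1 - c * 0) * (1 - q * 0))"
    unfolding r_def power_Suc by (intro tendsto_intros LIMSEQ_power_zero q) auto
  then have "(\<lambda>n. norm (r n)) \<longlonglongrightarrow> norm (z * A)"
    using tendsto_norm by (fastforce simp: mult.commute)
  moreover obtain d where d: "norm (z * A) < d" "d < 1"
    using zA dense by blast
  ultimately have "eventually (\<lambda>n. norm (r n) < d) sequentially"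
    by (simp add: order_tendstoD)
  then obtain N where N: "\<And>n. n \<ge> N \<Longrightarrow> norm (r n) < d"
    by (auto simp: eventually_sequentially)
  show ?thesis
  proof (rule summable_ratio_test[OF d(2), of N])
    fix n assume "n \<ge> N"
    then show "norm (norm (qgauss_term A z c q (Suc n))) \<le> d * norm (norm (qgauss_term A z c q n))"
      using N[of n] mult_right_mono[of "norm (r n)" d "norm (qgauss_term A z c q n)"]
      unfolding qgauss_term_Suc r_def[symmetric] norm_mult by (simp add: mult_ac)
  qed
qed

text \<open>Each numerator factor releases a \<open>q ^ N\<close>, and only the Pochhammer symbol of
  \<open>c\<close> changes below. This form isolates the decay \<open>q ^ (N * n)\<close> behind the
  limit in \<open>N\<close>; the quotient beside it stays bounded.\<close>

lemma qgauss_term_shift: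
  assumes "\<And>i. q ^ i * c \<noteq> 1"
  shows "qgauss_term A (z * q ^ N) (c * q ^ N) q n =
    q ^ (N * n) * (qpoch c q N * qpoch c q n / qpoch c q (N + n)) * qgauss_term A z c q n"
proof (induction n)
  case 0
  show ?case
    using qpoch_nonzero[of q c N] assms by (simp add: qgauss_term_def)
next
  case (Suc n)
  have 1: "qpoch c q (N + n) \<noteq> 0" "1 - c * q ^ n \<noteq> 0" "1 - c * (q ^ N * q ^ n) \<noteq> 0"
    using assms[of n] assms[of "N + n"] qpoch_nonzero[of q c "N + n"] assms
    by (metis mult.commute power_add right_minus_eq)+
  have 2: "z * q ^ N - c * q ^ N * q ^ n = q ^ N * (z - c * q ^ n)"
    by (simp add: algebra_simps)
  show ?case
    unfolding qgauss_term_Suc Suc 2 add_Suc_right qpoch_Suc mult_Suc_right power_add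
    using 1 by (simp add: divide_simps mult_ac)
qed

text \<open>Here \<open>x\<close> stands for \<open>q ^ n\<close> and \<open>t\<close> for the term
  of index \<open>n\<close>: the termwise form of the telescoping in
  \<open>qgauss_contiguous\<close>.\<close>

lemma qgauss_telescoping_identity:
  fixes A z c x t :: complex
  assumes "1 - c * x \<noteq> 0"
  shows "(1 - c) * (1 - z * A) * t - (1 - c * A) * (1 - z) * (x * ((1 - c) / (1 - c * x)) * t) =
    (1 - c) * ((1 - x) * t) - (1 - c) * (t * ((A - x) * (z - c * x) / (1 - c * x)))"
proof -
  \<comment> \<open>With the inverse as an unknown \<open>w\<close> bound by one polynomial
    relation, the claim is a polynomial identity.\<close>
  define w where "w = inverse (1 - c * x)"
  have "(1 - c * x) * w = 1" using assms by (simp add: w_def)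
  then show ?thesis
    unfolding divide_inverse w_def[symmetric] by algebra
qed

text \<open>The difference of the two sides, taken termwise, is a difference of consecutive values
  of \<open>(1 - c) * ((1 - q ^ n) * t n)\<close>, so its series telescopes.\<close>

lemma qgauss_contiguous:
  assumes q: "norm q < 1" and zA: "norm (z * A) < 1" and c: "\<And>i. q ^ i * c \<noteq> 1"
  shows "(1 - c) * (1 - z * A) * (\<Sum>n. qgauss_term A z c q n) =
         (1 - c * A) * (1 - z) * (\<Sum>n. qgauss_term A (z * q) (c * q) q n)"
proof -
  define t where "t = qgauss_term A z c q"
  define u where "u = qgauss_term A (z * q) (c * q) q"
  have zAq: "norm (z * q * A) < 1"
  proof -
    have "norm (z * q * A) = norm q * norm (z * A)"
      by (simp add: norm_mult)
    also have "\<dots> \<le> 1 * norm (z * A)"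
      using q by (intro mult_right_mono) auto
    finally show ?thesis using zA by simp
  qed
  have st: "summable t" and su: "summable u"
    unfolding t_def u_def
    using summable_norm_qgauss_term[OF q zA] summable_norm_qgauss_term[OF q zAq]
    by (auto intro: summable_norm_cancel)
  have step: "(1 - c) * (1 - z * A) * t n - (1 - c * A) * (1 - z) * u n =
        (1 - c) * ((1 - q ^ n) * t n) - (1 - c) * ((1 - q ^ Suc n) * t (Suc n))" for n
  proof -
    have nz: "1 - c * q ^ n \<noteq> 0" "1 - c \<noteq> 0" "1 - q ^ Suc n \<noteq> 0" "qpoch c q n \<noteq> 0"
      using c[of n] c[of 0] power_neq_one[OF q, of "Suc n"] qpoch_nonzero[of q c n] c
      by (metis mult.commute power_0 mult_1 right_minus_eq zero_less_Suc)+
    have un: "u n = q ^ n * ((1 - c) / (1 - c * q ^ n)) * t n"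
      using qgauss_term_shift[OF c, of A z 1 n] nz
      by (simp add: t_def u_def qpoch_Suc mult_ac)
    have ts: "(1 - q ^ Suc n) * t (Suc n) = t n * ((A - q ^ n) * (z - c * q ^ n) / (1 - c * q ^ n))"
      using nz by (simp add: t_def qgauss_term_Suc)
    show ?thesis
      unfolding un ts by (rule qgauss_telescoping_identity[OF nz(1)])
  qed
  \<comment> \<open>Both ends of the telescope vanish: the limit because \<open>t\<close> tends to
    0, the start because of the factor \<open>1 - q ^ 0\<close>.\<close>
  have "(\<lambda>n. (1 - c) * ((1 - q ^ n) * t n)) \<longlonglongrightarrow> (1 - c) * ((1 - 0) * 0)"
    by (intro tendsto_intros LIMSEQ_power_zero q summable_LIMSEQ_zero st)
  then have "(\<lambda>n. (1 - c) * ((1 - q ^ n) * t n) - (1 - c) * ((1 - q ^ Suc n) * t (Suc n))) sums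
      ((1 - c) * ((1 - q ^ 0) * t 0) - 0)"
    by (intro telescope_sums') simp
  then have "(\<lambda>n. (1 - c) * (1 - z * A) * t n - (1 - c * A) * (1 - z) * u n) sums 0"
    unfolding step by simp
  moreover have "(\<lambda>n. (1 - c) * (1 - z * A) * t n - (1 - c * A) * (1 - z) * u n) sums
      ((1 - c) * (1 - z * A) * suminf t - (1 - c * A) * (1 - z) * suminf u)"
    by (intro sums_diff sums_mult summable_sums st su)
  ultimately have "(1 - c) * (1 - z * A) * suminf t - (1 - c * A) * (1 - z) * suminf u = 0"
    using sums_unique2 by blast
  then show ?thesis
    by (simp only: t_def u_def right_minus_eq)
qed

lemma qgauss_iterate:
  assumes q: "norm q < 1" and zA: "norm (z * A) < 1" and c: "\<And>i. q ^ i * c \<noteq> 1"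
  shows "qpoch c q N * qpoch (z * A) q N * (\<Sum>n. qgauss_term A z c q n) =
         qpoch (c * A) q N * qpoch z q N * (\<Sum>n. qgauss_term A (z * q ^ N) (c * q ^ N) q n)"
proof (induction N)
  case (Suc N)
  have "norm (z * q ^ N * A) = norm q ^ N * norm (z * A)"
    by (simp add: norm_mult norm_power)
  also have "\<dots> \<le> 1 * norm (z * A)"
    using q by (intro mult_right_mono power_le_one) auto
  finally have zA': "norm (z * q ^ N * A) < 1" using zA by simp
  have c': "q ^ i * (c * q ^ N) \<noteq> 1" for i
    using c[of "i + N"] by (simp add: power_add mult_ac)
  note * = qgauss_contiguous[OF q zA' c']
  have "qpoch c q (Suc N) * qpoch (z * A) q (Suc N) * (\<Sum>n. qgauss_term A z c q n) =
     (1 - c * q ^ N) * (1 - z * q ^ N * A) *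
       (qpoch c q N * qpoch (z * A) q N * (\<Sum>n. qgauss_term A z c q n))"
    by (simp add: qpoch_Suc mult_ac)
  also have "\<dots> = qpoch (c * A) q N * qpoch z q N *
     ((1 - c * q ^ N) * (1 - z * q ^ N * A) *
       (\<Sum>n. qgauss_term A (z * q ^ N) (c * q ^ N) q n))"
    unfolding Suc by (simp add: mult_ac)
  also have "\<dots> = qpoch (c * A) q (Suc N) * qpoch z q (Suc N) *
     (\<Sum>n. qgauss_term A (z * q ^ Suc N) (c * q ^ Suc N) q n)"
    unfolding * by (simp add: qpoch_Suc mult_ac)
  finally show ?case .
qed simp

text \<open>The term of index 0 is 1 for every \<open>N\<close>; each later term carries at least a
  factor \<open>q ^ N\<close>, so the tail is dominated by a multiple of it.\<close>

lemma qgauss_tendsto_one: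
  assumes q: "norm q < 1" and zA: "norm (z * A) < 1" and c: "\<And>i. q ^ i * c \<noteq> 1"
  shows "(\<lambda>N. \<Sum>n. qgauss_term A (z * q ^ N) (c * q ^ N) q n) \<longlonglongrightarrow> 1"
proof -
  define t where "t = qgauss_term A z c q"
  define T where "T = (\<Sum>n. norm (t (Suc n)))"
  have st: "summable (\<lambda>n. norm (t (Suc n)))"
    using summable_norm_qgauss_term[OF q zA]
      iffD2[OF summable_Suc_iff[of "\<lambda>n. norm (t n)"]] by (simp only: t_def)
  obtain K1 where K1: "K1 > 0" "\<And>n. norm (qpoch c q n) \<le> K1"
    using Bseq_qpoch[OF q, of c] unfolding Bseq_def by blast
  obtain K2 where K2: "K2 > 0" "\<And>n. norm (inverse (qpoch c q n)) \<le> K2"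
    using Bseq_inverse_qpoch[OF q c] unfolding Bseq_def by blast
  \<comment> \<open>Bounds the quotient in \<open>qgauss_term_shift\<close>, uniformly in
    \<open>N\<close> and \<open>n\<close>: two symbols above, one inverse below.\<close>
  define K where "K = K1 * K1 * K2"
  have bound: "norm (qgauss_term A (z * q ^ N) (c * q ^ N) q (Suc n)) \<le>
      norm q ^ N * K * norm (t (Suc n))" for N n
  proof -
    have "norm q ^ (N * Suc n) \<le> norm q ^ N"
      using q by (intro power_decreasing) auto
    moreover have "norm (qpoch c q N * qpoch c q (Suc n) / qpoch c q (N + Suc n)) \<le> K"
      unfolding K_def divide_inverse norm_mult
      using K1 K2 by (intro mult_mono mult_nonneg_nonneg) (auto intro: less_imp_le)
    moreover have "K \<ge> 0"
      using K1(1) K2(1) by (simp add: K_def)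
    ultimately show ?thesis
      unfolding qgauss_term_shift[OF c] norm_mult[of _ "qgauss_term A z c q (Suc n)"]
        norm_mult[of "q ^ _"] norm_power t_def
      by (intro mult_mono mult_nonneg_nonneg) auto
  qed
  have main: "norm ((\<Sum>n. qgauss_term A (z * q ^ N) (c * q ^ N) q n) - 1) \<le> norm q ^ N * K * T" for N
  proof -
    let ?u = "qgauss_term A (z * q ^ N) (c * q ^ N) q"
    have s1: "summable (\<lambda>n. norm (?u (Suc n)))"
      by (rule summable_comparison_test'[OF summable_mult[OF st]]) (use bound in auto)
    have "summable ?u"
      using summable_norm_cancel[OF s1] by (rule iffD1[OF summable_Suc_iff])
    then have "suminf ?u - 1 = (\<Sum>n. ?u (Suc n))"
      by (subst suminf_split_head) (simp_all add: qgauss_term_def)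
    also have "norm \<dots> \<le> (\<Sum>n. norm (?u (Suc n)))"
      by (rule summable_norm[OF s1])
    also have "\<dots> \<le> (\<Sum>n. norm q ^ N * K * norm (t (Suc n)))"
      by (rule suminf_le[OF bound s1 summable_mult[OF st]])
    also have "\<dots> = norm q ^ N * K * T"
      unfolding T_def by (rule suminf_mult[OF st])
    finally show ?thesis .
  qed
  have "(\<lambda>N. norm q ^ N) \<longlonglongrightarrow> 0"
    using q by (intro LIMSEQ_power_zero) simp
  then have "(\<lambda>N. norm q ^ N * K * T) \<longlonglongrightarrow> 0"
    by (intro tendsto_mult_left_zero)
  then have "(\<lambda>N. (\<Sum>n. qgauss_term A (z * q ^ N) (c * q ^ N) q n) - 1) \<longlonglongrightarrow> 0"
    by (rule Lim_null_comparison[OF always_eventually[OF allI[OF main]]])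
  then show ?thesis
    by (simp add: LIM_zero_iff)
qed

text \<open>Lets \<open>N\<close> tend to infinity in \<open>qgauss_iterate\<close>, where the
  shifted series tends to 1.\<close>

theorem qgauss_sum:
  assumes q: "norm q < 1" and zA: "norm (z * A) < 1" and c: "\<And>i. q ^ i * c \<noteq> 1"
  shows "(\<Sum>n. qgauss_term A z c q n) =
    qpoch_inf (c * A) q * qpoch_inf z q / (qpoch_inf c q * qpoch_inf (z * A) q)"
proof -
  have "qpoch_inf c q * qpoch_inf (z * A) q * (\<Sum>n. qgauss_term A z c q n) =
      qpoch_inf (c * A) q * qpoch_inf z q * 1"
  proof (rule LIMSEQ_unique)
    show "(\<lambda>N. qpoch c q N * qpoch (z * A) q N * (\<Sum>n. qgauss_term A z c q n)) \<longlonglongrightarrow>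
        qpoch_inf c q * qpoch_inf (z * A) q * (\<Sum>n. qgauss_term A z c q n)"
      by (intro tendsto_intros qpoch_tendsto[OF q])
    show "(\<lambda>N. qpoch c q N * qpoch (z * A) q N * (\<Sum>n. qgauss_term A z c q n)) \<longlonglongrightarrow>
        qpoch_inf (c * A) q * qpoch_inf z q * 1"
      unfolding qgauss_iterate[OF assms]
      by (intro tendsto_intros qpoch_tendsto[OF q] qgauss_tendsto_one[OF assms])
  qed
  moreover have "qpoch_inf c q \<noteq> 0" "qpoch_inf (z * A) q \<noteq> 0"
    by (intro qpoch_inf_nonzero[OF q] c power_mult_neq_one[OF q zA])+
  ultimately show ?thesis
    by (simp add: nonzero_eq_divide_eq mult.commute)
qed

subsection \<open>The Bailey pair\<close>

text \<open>For \<open>a j = 1 / qpoch q q j\<close> the convolution has generating function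
  \<open>1 / ((x; q)\<^sub>\<infinity> (-x; q)\<^sub>\<infinity>) = 1 / (x\<^sup>2;
  q\<^sup>2)\<^sub>\<infinity>\<close>, which explains the recurrence in steps of two. The proof
  stays with finite sums and pairs \<open>S\<close> with a twisted companion
  \<open>D\<close>.\<close>

lemma alternating_convolution_rec:
  fixes a :: "nat \<Rightarrow> complex"
  assumes a: "\<And>n. a (Suc n) * (1 - q ^ Suc n) = a n"
  shows "(1 - q ^ Suc (Suc n)) * (\<Sum>j\<le>Suc (Suc n). (-1) ^ j * a j * a (Suc (Suc n) - j)) =
    (\<Sum>j\<le>n. (-1) ^ j * a j * a (n - j))"
proof -
  define S where "S m = (\<Sum>j\<le>m. (-1) ^ j * a j * a (m - j))" for m
  define D where "D m = (\<Sum>j\<le>m. (-1) ^ j * q ^ j * a j * a (m - j))" for m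
  \<comment> \<open>The term \<open>j = 0\<close> vanishes with \<open>1 - q ^ 0\<close>, and
    lowering the index of the first factor flips the sign.\<close>
  have 1: "(\<Sum>j\<le>Suc m. (-1) ^ j * (a j * (1 - q ^ j)) * a (Suc m - j)) = - S m" for m
    unfolding sum.atMost_Suc_shift S_def a by (simp add: sum_negf)
  have 2: "(\<Sum>j\<le>Suc m. (-1) ^ j * q ^ j * a j * (a (Suc m - j) * (1 - q ^ (Suc m - j)))) = D m" for m
    unfolding D_def by (simp add: Suc_diff_le a[unfolded power_Suc])
  have 3: "S (Suc m) - D (Suc m) = - S m" for m
    unfolding 1[symmetric] S_def[of "Suc m"] D_def sum_subtractf[symmetric]
    by (intro sum.cong) (simp_all add: algebra_simps)
  have 4: "(1 - q ^ Suc m) * S (Suc m) = - S m + D m" for m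
  proof -
    \<comment> \<open>Splits \<open>1 - q ^ Suc m\<close> as
      \<open>(1 - q ^ j) + q ^ j * (1 - q ^ (Suc m - j))\<close>, so that each part lowers the index
      of one factor.\<close>
    have "(1 - q ^ Suc m) * ((-1) ^ j * a j * a (Suc m - j)) =
        (-1) ^ j * (a j * (1 - q ^ j)) * a (Suc m - j) +
        (-1) ^ j * q ^ j * a j * (a (Suc m - j) * (1 - q ^ (Suc m - j)))" if "j \<le> Suc m" for j
    proof -
      have "q ^ Suc m = q ^ j * q ^ (Suc m - j)"
        using that by (simp only: power_add[symmetric] le_add_diff_inverse)
      then show ?thesis
        by (simp only:) (simp add: algebra_simps)
    qed
    then have "(1 - q ^ Suc m) * S (Suc m) =
        (\<Sum>j\<le>Suc m. (-1) ^ j * (a j * (1 - q ^ j)) * a (Suc m - j)) +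
        (\<Sum>j\<le>Suc m. (-1) ^ j * q ^ j * a j * (a (Suc m - j) * (1 - q ^ (Suc m - j))))"
      unfolding S_def sum_distrib_left sum.distrib[symmetric] by (intro sum.cong) auto
    then show ?thesis
      unfolding 1 2 .
  qed
  show ?thesis
    unfolding S_def[symmetric] 4[of "Suc n"] using 3[of n] by (simp add: algebra_simps)
qed

lemma qpoch_self_nonzero:
  assumes "norm q < 1"
  shows "qpoch q q n \<noteq> 0"
  by (rule qpoch_nonzero[OF power_mult_neq_one[OF assms assms]])

text \<open>The alternating sum of the Gaussian binomial coefficients \<open>[2n, j]\<close>, divided by \<open>(q; q)\<^bsub>2n\<^esub>\<close>.\<close>

lemma alternating_qbinomial_sum:
  assumes q: "norm q < 1"
  shows "(\<Sum>j\<le>2 * n. (-1) ^ j / (qpoch q q j * qpoch q q (2 * n - j))) =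
    1 / qpoch (q ^ 2) (q ^ 2) n"
proof (induction n)
  case (Suc n)
  have aux: "c * s = 1 / p \<Longrightarrow> p' = p * c \<Longrightarrow> c \<noteq> 0 \<Longrightarrow> s = 1 / p'" for c s p p' :: complex
    by (metis divide_divide_eq_left nonzero_mult_div_cancel_left)
  define a where "a j = 1 / qpoch q q j" for j
  have a: "a (Suc j) * (1 - q ^ Suc j) = a j" for j
    using power_neq_one[OF q, of "Suc j"] qpoch_self_nonzero[OF q, of j]
    by (simp add: a_def qpoch_Suc mult.commute[of _ q])
  have "(1 - q ^ Suc (Suc (2 * n))) * (\<Sum>j\<le>2 * Suc n. (-1) ^ j * a j * a (2 * Suc n - j)) =
      (\<Sum>j\<le>2 * n. (-1) ^ j * a j * a (2 * n - j))"
    using alternating_convolution_rec[OF a, of "2 * n"] by simp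
  then have "(1 - q ^ Suc (Suc (2 * n))) *
      (\<Sum>j\<le>2 * Suc n. (-1) ^ j / (qpoch q q j * qpoch q q (2 * Suc n - j))) =
      1 / qpoch (q ^ 2) (q ^ 2) n"
    using Suc by (simp add: a_def)
  moreover have "qpoch (q ^ 2) (q ^ 2) (Suc n) = qpoch (q ^ 2) (q ^ 2) n * (1 - q ^ Suc (Suc (2 * n)))"
    by (simp add: qpoch_Suc power_mult[symmetric] power_add[symmetric])
  moreover have "1 - q ^ Suc (Suc (2 * n)) \<noteq> 0"
    using power_neq_one[OF q, of "Suc (Suc (2 * n))"] by (metis right_minus_eq zero_less_Suc)
  ultimately show ?case
    by (rule aux)
qed simp

section \<open>Partial sums over \<open>m\<close> and the telescoping argument for the Bailey
  pair\<close>

definition hecke_sum :: "complex \<Rightarrow> nat \<Rightarrow> complex" where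
  "hecke_sum q r = (\<Sum>m\<in>{- int r..int r}. (-1) powi m * q powi (- (m ^ 2)))"

lemma hecke_sum_0 [simp]: "hecke_sum q 0 = 1"
  by (simp add: hecke_sum_def)

text \<open>The two new terms \<open>m = r + 1\<close> and \<open>m = - (r + 1)\<close> coincide.
  Summation by parts uses only this increment.\<close>

lemma hecke_sum_Suc:
  "hecke_sum q (Suc r) = hecke_sum q r + 2 * (-1) ^ Suc r / q ^ (Suc r ^ 2)"
proof -
  have "{- int (Suc r)..int (Suc r)} =
      insert (int (Suc r)) (insert (- int (Suc r)) {- int r..int r})"
    by auto
  moreover have "(-1 :: complex) powi (- int (Suc r)) = (-1) powi int (Suc r)"
    by (simp only: power_int_minus_one_minus)
  moreover have "q powi (- (int (Suc r) ^ 2)) = 1 / q ^ (Suc r ^ 2)"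
    unfolding of_nat_power[symmetric] power_int_minus power_int_of_nat by (rule inverse_eq_divide)
  ultimately show ?thesis
    by (simp add: hecke_sum_def power_int_of_nat del: of_nat_Suc power_Suc)
qed

text \<open>Folds the sum of \<open>alternating_qbinomial_sum\<close> at its middle index, the shape
  in which summation by parts delivers it.\<close>

lemma sum_symmetric_about_middle:
  fixes f :: "nat \<Rightarrow> complex"
  assumes "\<And>r. r \<le> n \<Longrightarrow> f (n - r) = f (n + r)"
  shows "(\<Sum>j\<le>2 * n. f j) = f n + 2 * (\<Sum>r<n. f (n + Suc r))"
proof -
  have *: "(\<Sum>j\<le>n + k. f j) = (\<Sum>j<n. f j) + f n + (\<Sum>r<k. f (n + Suc r))" for k
    by (induction k) (simp_all only: add_0_right lessThan_Suc_atMost[symmetric] sum.lessThan_Suc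
        add_Suc_right sum.atMost_Suc lessThan_0 sum.empty add.assoc)
  have "(\<Sum>j<n. f j) = (\<Sum>r<n. f (n - Suc r))"
    by (rule sum.nat_diff_reindex[symmetric])
  also have "\<dots> = (\<Sum>r<n. f (n + Suc r))"
    using assms by (intro sum.cong) auto
  finally show ?thesis
    using *[of n] by (simp only: mult_2 add.assoc add.commute[of _ "f n"])
qed

lemma summation_by_parts:
  fixes G s :: "nat \<Rightarrow> complex"
  shows "(\<Sum>r\<le>k. (G r - G (Suc r)) * s r) + G (Suc k) * s k =
    G 0 * s 0 + (\<Sum>r<k. G (Suc r) * (s (Suc r) - s r))"
  by (induction k) (simp_all add: algebra_simps)

theorem bailey_pair:
  assumes q: "norm q < 1" and q0: "q \<noteq> 0"
  shows "(\<Sum>r\<le>n. q ^ (r ^ 2) * (1 - q ^ (2 * r + 1)) * hecke_sum q r /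
      (qpoch q q (n - r) * qpoch q q (n + r + 1))) = (-1) ^ n / qpoch (q ^ 2) (q ^ 2) n"
proof -
  note nz = qpoch_self_nonzero[OF q]
  \<comment> \<open>The telescoping antiderivative. Cutting it off beyond \<open>n\<close> gives the
    last difference its right value and kills the boundary term of the summation by parts.\<close>
  define G where "G r = (if r \<le> n then q ^ (r ^ 2) / (qpoch q q (n - r) * qpoch q q (n + r)) else 0)" for r
  have G: "q ^ (r ^ 2) * (1 - q ^ (2 * r + 1)) / (qpoch q q (n - r) * qpoch q q (n + r + 1)) =
      G r - G (Suc r)" if "r \<le> n" for r
  proof (cases "r = n")
    case True
    have "1 - q ^ (2 * n + 1) \<noteq> 0"
      using power_neq_one[OF q, of "2 * n + 1"] by (metis right_minus_eq add_gr_0 zero_less_one)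
    moreover have "qpoch q q (n + r + 1) = qpoch q q (n + r) * (1 - q ^ (2 * n + 1))"
      by (simp add: True qpoch_Suc mult_2[symmetric] mult.commute[of _ q])
    ultimately show ?thesis
      by (simp add: True G_def)
  next
    case False
    with that obtain k where n: "n = Suc (r + k)"
      by (metis le_neq_implies_less less_iff_Suc_add)
    \<comment> \<open>Here \<open>u\<close> is \<open>q ^ (n - r)\<close> and \<open>v * u\<close>
      is \<open>q ^ (n + r + 1)\<close>; the difference then rests on
      \<open>(1 - v * u) - v * (1 - u) = 1 - v\<close>.\<close>
    define u where "u = q ^ Suc k"
    define v where "v = q ^ (2 * r + 1)"
    have uv: "1 - u \<noteq> 0" "1 - v * u \<noteq> 0"
      using power_neq_one[OF q, of "Suc k"] power_neq_one[OF q, of "2 * r + 1 + Suc k"]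
      unfolding u_def v_def power_add[symmetric] by (metis right_minus_eq add_gr_0 zero_less_Suc)+
    have e1: "n - r = Suc k" "n - Suc r = k" "n + r = Suc (2 * r + k)" "n + Suc r = Suc (Suc (2 * r + k))"
      using n by auto
    have e2: "n + r + 1 = Suc (Suc (2 * r + k))"
      using n by auto
    have p1: "qpoch q q (Suc k) = qpoch q q k * (1 - u)"
      by (simp add: qpoch_Suc u_def mult.commute[of _ q])
    have p2: "qpoch q q (Suc (Suc (2 * r + k))) = qpoch q q (Suc (2 * r + k)) * (1 - v * u)"
      unfolding qpoch_Suc[of q q "Suc (2 * r + k)"] u_def v_def power_add[symmetric]
      by (simp add: power_add mult_ac)
    have p3: "q ^ (Suc r ^ 2) = q ^ (r ^ 2) * v"
      unfolding v_def power_add[symmetric] by (simp add: power2_eq_square mult_2 add_ac)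
    have g1: "G r = q ^ (r ^ 2) / (qpoch q q k * (1 - u) * qpoch q q (Suc (2 * r + k)))"
      using that unfolding G_def e1 p1 by simp
    have g2: "G (Suc r) = q ^ (r ^ 2) * v / (qpoch q q k * (qpoch q q (Suc (2 * r + k)) * (1 - v * u)))"
      using n unfolding G_def e1 p2 p3 by simp
    have g3: "q ^ (r ^ 2) * (1 - q ^ (2 * r + 1)) / (qpoch q q (n - r) * qpoch q q (n + r + 1)) =
      q ^ (r ^ 2) * (1 - v) / (qpoch q q k * (1 - u) * (qpoch q q (Suc (2 * r + k)) * (1 - v * u)))"
      by (simp only: e2 e1(1) v_def[symmetric] p1 p2)
    define P where "P = qpoch q q k"
    define R where "R = qpoch q q (Suc (2 * r + k))"
    define Q where "Q = q ^ (r ^ 2)"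
    have "P \<noteq> 0" "R \<noteq> 0" by (simp_all add: P_def R_def nz)
    then show ?thesis
      unfolding g1 g2 g3
      unfolding P_def[symmetric] R_def[symmetric] Q_def[symmetric]
      using uv by (simp add: divide_simps) (simp add: algebra_simps)
  qed
  define f where "f j = (-1) ^ j / (qpoch q q j * qpoch q q (2 * n - j))" for j
  have f_mid: "f (n + r) = (-1) ^ n * ((-1) ^ r / (qpoch q q (n - r) * qpoch q q (n + r)))" if "r \<le> n" for r
    using that by (simp add: f_def power_add mult_2 mult_ac)
  have f_sym: "f (n - r) = f (n + r)" if "r \<le> n" for r
  proof -
    have "(-1 :: complex) ^ (n - r) = (-1) ^ (n + r)"
      using that by (simp add: power_add power_diff divide_simps)
    moreover have "2 * n - (n - r) = n + r" "2 * n - (n + r) = n - r"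
      using that by auto
    ultimately show ?thesis
      by (simp add: f_def mult.commute)
  qed
  \<comment> \<open>The increment of \<open>hecke_sum\<close> cancels the power of \<open>q\<close>
    in \<open>G\<close>, leaving a symmetric pair of summands of the alternating sum.\<close>
  have step: "G (Suc r) * (hecke_sum q (Suc r) - hecke_sum q r) = 2 * ((-1) ^ n * f (n + Suc r))"
    if "r < n" for r
  proof -
    have "(-1 :: complex) ^ n * (-1) ^ n = 1"
      by (simp add: power_mult_distrib[symmetric])
    then show ?thesis
      using that q0 f_mid[of "Suc r"] nz[of "n - Suc r"] nz[of "n + Suc r"]
      by (simp add: G_def hecke_sum_Suc mult.assoc[symmetric])
  qed
  have G0: "G 0 * hecke_sum q 0 = (-1) ^ n * f n"
    using f_mid[of 0] by (simp add: G_def mult.assoc[symmetric] power_mult_distrib[symmetric])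
  have "(\<Sum>r\<le>n. q ^ (r ^ 2) * (1 - q ^ (2 * r + 1)) * hecke_sum q r /
      (qpoch q q (n - r) * qpoch q q (n + r + 1))) = (\<Sum>r\<le>n. (G r - G (Suc r)) * hecke_sum q r)"
    by (intro sum.cong refl) (simp add: G[symmetric])
  also have "\<dots> = (\<Sum>r\<le>n. (G r - G (Suc r)) * hecke_sum q r) + G (Suc n) * hecke_sum q n"
    by (simp add: G_def)
  also have "\<dots> = (-1) ^ n * f n + (\<Sum>r<n. 2 * ((-1) ^ n * f (n + Suc r)))"
    unfolding summation_by_parts G0 using step by simp
  also have "\<dots> = (-1) ^ n * (f n + 2 * (\<Sum>r<n. f (n + Suc r)))"
    by (simp add: sum_distrib_left algebra_simps)
  also have "\<dots> = (-1) ^ n * (\<Sum>j\<le>2 * n. f j)"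
    using sum_symmetric_about_middle[of n f] f_sym by simp
  also have "\<dots> = (-1) ^ n / qpoch (q ^ 2) (q ^ 2) n"
    unfolding f_def alternating_qbinomial_sum[OF q] by simp
  finally show ?thesis .
qed

subsection \<open>Bailey's lemma\<close>

text \<open>Passes from a series of finite row sums to an unconditional sum over pairs, where
  reindexing is free, and back.\<close>

lemma sums_Sigma_nat:
  fixes f :: "nat \<Rightarrow> 'b \<Rightarrow> complex"
  assumes fin: "\<And>n. finite (B n)"
    and sm: "summable (\<lambda>n. \<Sum>x\<in>B n. norm (f n x))"
  shows "(\<lambda>(n, x). f n x) summable_on (Sigma UNIV B)"
    and "((\<lambda>(n, x). f n x) has_sum S) (Sigma UNIV B) \<Longrightarrow> (\<lambda>n. \<Sum>x\<in>B n. f n x) sums S"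
proof -
  show "(\<lambda>(n, x). f n x) summable_on (Sigma UNIV B)"
  proof (rule Infinite_Sum.abs_summable_summable,
      rule iffD2[OF Infinite_Sum.abs_summable_on_Sigma_iff], intro conjI ballI)
    fix n
    show "(\<lambda>x. norm ((\<lambda>(n, x). f n x) (n, x))) summable_on B n"
      by (simp add: fin)
  next
    show "(\<lambda>n. norm (\<Sum>\<^sub>\<infinity>x\<in>B n. norm ((\<lambda>(n, x). f n x) (n, x)))) summable_on UNIV"
      by (rule norm_summable_imp_summable_on) (use sm in \<open>simp add: fin sum_nonneg\<close>)
  qed
  assume "((\<lambda>(n, x). f n x) has_sum S) (Sigma UNIV B)"
  then have "((\<lambda>n. \<Sum>x\<in>B n. f n x) has_sum S) UNIV"
    by (rule has_sum_SigmaD) (auto intro!: has_sum_finiteI fin)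
  then show "(\<lambda>n. \<Sum>x\<in>B n. f n x) sums S"
    by (rule has_sum_imp_sums)
qed

text \<open>Writing \<open>n = r + k\<close> turns the triangle \<open>r \<le> n\<close> into a full
  quadrant, which may be summed over \<open>k\<close> first. This is the interchange in Bailey's
  lemma.\<close>

lemma triangle_sum_swap:
  fixes f :: "nat \<Rightarrow> nat \<Rightarrow> complex"
  assumes sm: "summable (\<lambda>n. \<Sum>r\<le>n. norm (f n r))"
  obtains S where "(\<lambda>n. \<Sum>r\<le>n. f n r) sums S" and "(\<lambda>r. \<Sum>k. f (r + k) r) sums S"
proof -
  note Sig = sums_Sigma_nat[of "\<lambda>n. {..n}" f, OF _ sm, simplified]
  from Sig(1) obtain S
    where S: "((\<lambda>(n, r). f n r) has_sum S) (Sigma UNIV (\<lambda>n. {..n}))"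
    unfolding summable_on_def by blast
  then have S': "((\<lambda>(r, k). f (r + k) r) has_sum S) (Sigma UNIV (\<lambda>_. UNIV))"
    by (subst has_sum_reindex_bij_witness[where j = "\<lambda>(r, k). (r + k, r)" and
          i = "\<lambda>(n, r). (r, n - r)" and h = "\<lambda>(n, r). f n r" and s' = S and
          T = "Sigma UNIV (\<lambda>n. {..n})"]) auto
  have row: "((\<lambda>k. f (r + k) r) has_sum (\<Sum>k. f (r + k) r)) UNIV" for r
  proof -
    have "(\<lambda>k. f (r + k) r) summable_on UNIV"
      using summable_on_SigmaD1[of "\<lambda>r k. f (r + k) r" UNIV "\<lambda>_. UNIV" r] S'
      by (auto simp: summable_on_def)
    then show ?thesis
      by (metis has_sum_imp_sums sums_unique summable_iff_has_sum_infsum)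
  qed
  have "((\<lambda>r. \<Sum>k. f (r + k) r) has_sum S) UNIV"
    by (rule has_sum_SigmaD[OF S']) (use row in simp)
  then show ?thesis
    using that Sig(2)[OF S] has_sum_imp_sums by blast
qed

text \<open>The weight \<open>(\<rho>\<^sub>1; q)\<^sub>n (\<rho>\<^sub>2; q)\<^sub>n (a q / (\<rho>\<^sub>1 \<rho>\<^sub>2))\<^sup>n\<close> of Bailey's lemma for \<open>a = q\<close>,
  where \<open>A = 1 / \<rho>\<^sub>1\<close> and \<open>B = 1 / \<rho>\<^sub>2\<close>.\<close>

definition bailey_weight :: "complex \<Rightarrow> complex \<Rightarrow> complex \<Rightarrow> nat \<Rightarrow> complex" where
  "bailey_weight A B q n = (\<Prod>i<n. (A - q ^ i) * (B - q ^ i) * q ^ 2)"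

lemma bailey_weight_Suc:
  "bailey_weight A B q (Suc n) = bailey_weight A B q n * ((A - q ^ n) * (B - q ^ n) * q ^ 2)"
  by (simp add: bailey_weight_def)

text \<open>The dependence on \<open>k\<close> is a q-Gauss summand with
  \<open>c = q ^ (2 * r + 2)\<close> whose two numerator parameters are those of the weight times
  \<open>q ^ r\<close>.\<close>

lemma bailey_weight_add:
  assumes q0: "q \<noteq> 0"
  shows "bailey_weight A B q (r + k) / (qpoch q q k * qpoch q q (2 * r + k + 1)) =
    bailey_weight A B q r / qpoch q q (2 * r + 1) *
      qgauss_term (A / q ^ r) (q ^ (r + 2) * B) (q ^ (2 * r + 2)) q k"
proof (induction k)
  case (Suc k)
  have 1: "(A / q ^ r - q ^ k) * (q ^ (r + 2) * B - q ^ (2 * r + 2) * q ^ k) =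
      (A - q ^ (r + k)) * (B - q ^ (r + k)) * q ^ 2"
    using q0 by (simp add: divide_simps) (simp add: power_add power_mult power2_eq_square algebra_simps)
  have 2: "1 - q ^ (2 * r + 2) * q ^ k = 1 - q ^ (2 * r + k + 1) * q"
    by (simp add: power_add power2_eq_square)
  have "bailey_weight A B q (r + Suc k) / (qpoch q q (Suc k) * qpoch q q (2 * r + Suc k + 1)) =
      bailey_weight A B q (r + k) / (qpoch q q k * qpoch q q (2 * r + k + 1)) *
      ((A - q ^ (r + k)) * (B - q ^ (r + k)) * q ^ 2 /
        ((1 - q ^ (2 * r + k + 1) * q) * (1 - q ^ k * q)))"
    using qpoch_Suc[of q q "2 * r + k + 1"] by (simp add: bailey_weight_Suc qpoch_Suc[of q q k] mult_ac)
  also have "\<dots> = bailey_weight A B q r / qpoch q q (2 * r + 1) *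
      qgauss_term (A / q ^ r) (q ^ (r + 2) * B) (q ^ (2 * r + 2)) q (Suc k)"
    unfolding Suc qgauss_term_Suc 1 2 power_Suc2[of q k] by (simp only: mult.assoc)
  finally show ?case .
qed (simp add: qgauss_term_def)

text \<open>The conjugate Bailey pair: the q-Gauss sum evaluates the column of index
  \<open>r\<close>. The product \<open>z * A\<close> is \<open>q ^ 2 * A * B\<close> for every
  \<open>r\<close>.\<close>

lemma bailey_weight_conjugate:
  assumes q: "norm q < 1" and q0: "q \<noteq> 0" and AB: "norm (q ^ 2 * A * B) < 1"
  shows "(\<Sum>k. bailey_weight A B q (r + k) / (qpoch q q k * qpoch q q (2 * r + k + 1))) =
    bailey_weight A B q r * qpoch_inf (q ^ (r + 2) * A) q * qpoch_inf (q ^ (r + 2) * B) q /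
      (qpoch_inf q q * qpoch_inf (q ^ 2 * A * B) q)"
proof -
  have zA: "q ^ (r + 2) * B * (A / q ^ r) = q ^ 2 * A * B"
    using q0 by (simp add: power_add power2_eq_square)
  have cA: "q ^ (2 * r + 2) * (A / q ^ r) = q ^ (r + 2) * A"
    using q0 by (simp add: power_add mult_2)
  have c: "q ^ i * q ^ (2 * r + 2) \<noteq> 1" for i
    unfolding power_add[symmetric] by (rule power_neq_one[OF q]) simp
  have zA_less: "norm (q ^ (r + 2) * B * (A / q ^ r)) < 1"
    unfolding zA by (rule AB)
  have "(\<Sum>k. bailey_weight A B q (r + k) / (qpoch q q k * qpoch q q (2 * r + k + 1))) =
    bailey_weight A B q r / qpoch q q (2 * r + 1) *
      (qpoch_inf (q ^ (r + 2) * A) q * qpoch_inf (q ^ (r + 2) * B) q /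
        (qpoch_inf (q ^ (2 * r + 2)) q * qpoch_inf (q ^ 2 * A * B) q))"
    unfolding bailey_weight_add[OF q0]
      suminf_mult[OF summable_norm_cancel[OF summable_norm_qgauss_term[OF q zA_less]]]
      qgauss_sum[OF q zA_less c] zA cA ..
  \<comment> \<open>The finite and the infinite product merge, so the denominator no longer depends
    on \<open>r\<close>.\<close>
  moreover have "qpoch_inf q q = qpoch q q (2 * r + 1) * qpoch_inf (q ^ (2 * r + 2)) q"
    using qpoch_inf_shift[OF q, of q "2 * r + 1"] by (simp add: mult.commute)
  ultimately show ?thesis
    by (simp add: mult_ac)
qed

text \<open>The square pays for the \<open>n + 1\<close> values of \<open>r\<close> and for the
  linear growth of the other factor in \<open>bailey_transform\<close>.\<close>

lemma summable_bailey_weight: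
  assumes q: "norm q < 1" and AB: "norm (q ^ 2 * A * B) < 1"
  shows "summable (\<lambda>n. norm (bailey_weight A B q n) * (real n + 1) ^ 2)"
proof -
  define r where "r n = norm ((A - q ^ n) * (B - q ^ n) * q ^ 2) * (1 + 1 / (real n + 1)) ^ 2" for n
  have "(\<lambda>n. 1 / (real n + 1)) \<longlonglongrightarrow> 0"
    using LIMSEQ_inverse_real_of_nat by (simp add: inverse_eq_divide add.commute)
  then have "r \<longlonglongrightarrow> norm ((A - 0) * (B - 0) * q ^ 2) * (1 + 0) ^ 2"
    unfolding r_def by (intro tendsto_intros LIMSEQ_power_zero q)
  then have lim: "r \<longlonglongrightarrow> norm (q ^ 2 * A * B)"
    by (simp add: mult_ac)
  obtain d where d: "norm (q ^ 2 * A * B) < d" "d < 1"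
    using AB dense by blast
  from order_tendstoD(2)[OF lim d(1)] obtain N where N: "\<And>n. n \<ge> N \<Longrightarrow> r n < d"
    by (auto simp: eventually_sequentially)
  have r0: "r n \<ge> 0" for n
    by (simp add: r_def)
  have r: "norm (bailey_weight A B q (Suc n)) * (real (Suc n) + 1) ^ 2 =
      r n * (norm (bailey_weight A B q n) * (real n + 1) ^ 2)" for n
  proof -
    have "real (Suc n) + 1 = (1 + 1 / (real n + 1)) * (real n + 1)"
      by (simp add: field_simps)
    then show ?thesis
      unfolding bailey_weight_Suc norm_mult[of "bailey_weight A B q n"] r_def
      by (simp only: power_mult_distrib mult_ac)
  qed
  show ?thesis
  proof (rule summable_ratio_test[OF d(2), of N])
    fix n assume "n \<ge> N"
    then show "norm (norm (bailey_weight A B q (Suc n)) * (real (Suc n) + 1) ^ 2) \<le>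
        d * norm (norm (bailey_weight A B q n) * (real n + 1) ^ 2)"
      unfolding r real_norm_def abs_mult using N[of n] r0[of n]
      by (intro mult_right_mono) (auto simp: abs_mult)
  qed
qed

text \<open>The prefactor makes every exponent \<open>r ^ 2 - m ^ 2\<close> nonnegative, which
  leaves \<open>2 * r + 1\<close> terms of norm at most 1.\<close>

lemma norm_hecke_sum_le:
  assumes q: "norm q < 1" and q0: "q \<noteq> 0"
  shows "norm (q ^ (r ^ 2) * hecke_sum q r) \<le> 2 * real r + 1"
proof -
  have "norm (q ^ (r ^ 2) * ((-1) powi m * q powi (- (m ^ 2)))) \<le> 1" if m: "m \<in> {- int r..int r}" for m
  proof -
    have "m ^ 2 \<le> int r ^ 2"
      using m by (intro power2_le_iff_abs_le[THEN iffD2]) auto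
    then obtain k where k: "int (r ^ 2) + - (m ^ 2) = int k"
      using zero_le_imp_eq_int[of "int (r ^ 2) + - (m ^ 2)"] by auto
    have "q ^ (r ^ 2) * q powi (- (m ^ 2)) = q ^ k"
      unfolding power_int_of_nat[symmetric] k[symmetric] by (rule power_int_add[symmetric]) (simp add: q0)
    then have "q ^ (r ^ 2) * ((-1) powi m * q powi (- (m ^ 2))) = (-1) powi m * q ^ k"
      by (simp only: mult.left_commute[of "q ^ (r ^ 2)"])
    then have "norm (q ^ (r ^ 2) * ((-1) powi m * q powi (- (m ^ 2)))) = norm q ^ k"
      by (simp only: norm_mult norm_power norm_power_int) simp
    also have "\<dots> \<le> 1"
      using q by (intro power_le_one) auto
    finally show ?thesis .
  qed
  then have "norm (q ^ (r ^ 2) * hecke_sum q r) \<le> of_nat (card {- int r..int r}) * 1"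
    unfolding hecke_sum_def sum_distrib_left by (intro order_trans[OF norm_sum] sum_bounded_above)
  then show ?thesis
    by simp
qed

text \<open>One absolutely convergent triangular sum is evaluated twice: by rows with
  \<open>bailey_pair\<close>, by columns with \<open>bailey_weight_conjugate\<close>. Obtaining
  \<open>S\<close> through \<open>sums\<close> records convergence together with the value.\<close>

theorem bailey_transform:
  assumes q: "norm q < 1" and q0: "q \<noteq> 0" and AB: "norm (q ^ 2 * A * B) < 1"
  obtains S where
    "(\<lambda>n. bailey_weight A B q n * (-1) ^ n / qpoch (q ^ 2) (q ^ 2) n) sums
      (S / (qpoch_inf q q * qpoch_inf (q ^ 2 * A * B) q))"
    "(\<lambda>r. bailey_weight A B q r * qpoch_inf (q ^ (r + 2) * A) q * qpoch_inf (q ^ (r + 2) * B) q *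
      (q ^ (r ^ 2) * (1 - q ^ (2 * r + 1)) * hecke_sum q r)) sums S"
proof -
  define a where "a r = q ^ (r ^ 2) * (1 - q ^ (2 * r + 1)) * hecke_sum q r" for r
  define f where "f n r = bailey_weight A B q n / (qpoch q q (n - r) * qpoch q q (n + r + 1)) * a r" for n r
  define C where "C = qpoch_inf q q * qpoch_inf (q ^ 2 * A * B) q"
  have C: "C \<noteq> 0"
    unfolding C_def using qpoch_inf_nonzero[OF q power_mult_neq_one[OF q q]]
      qpoch_inf_nonzero[OF q power_mult_neq_one[OF q AB]] by simp
  obtain K where K: "K > 0" "\<And>n. norm (inverse (qpoch q q n)) \<le> K"
    using Bseq_inverse_qpoch[OF q power_mult_neq_one[OF q q]] unfolding Bseq_def by blast
  have a_le: "norm (a r) \<le> 2 * (2 * real r + 1)" for r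
  proof -
    have "norm (q ^ (2 * r + 1)) \<le> 1"
      unfolding norm_power using q by (intro power_le_one) auto
    then have "norm (1 - q ^ (2 * r + 1)) \<le> 1 + 1"
      using norm_triangle_ineq4[of 1 "q ^ (2 * r + 1)"] by simp
    then have "norm (1 - q ^ (2 * r + 1)) * norm (q ^ (r ^ 2) * hecke_sum q r) \<le> 2 * (2 * real r + 1)"
      using norm_hecke_sum_le[OF q q0, of r] by (intro mult_mono) auto
    then show ?thesis
      unfolding norm_mult[symmetric] a_def by (simp only: mult_ac)
  qed
  have f_le: "norm (f n r) \<le> norm (bailey_weight A B q n) * (K * K) * (4 * (real n + 1))" if "r \<le> n" for n r
  proof -
    have "norm (a r) \<le> 4 * (real n + 1)"
      using a_le[of r] that by simp
    moreover have "norm (inverse (qpoch q q (n - r)) * inverse (qpoch q q (n + r + 1))) \<le> K * K"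
      unfolding norm_mult using K by (intro mult_mono) auto
    moreover have "f n r = bailey_weight A B q n *
        (inverse (qpoch q q (n - r)) * inverse (qpoch q q (n + r + 1))) * a r"
      by (simp add: f_def divide_inverse)
    ultimately show ?thesis
      using K(1) by (simp only: norm_mult[of _ "a r"] norm_mult[of "bailey_weight A B q n"])
        (intro mult_mono, auto)
  qed
  have "summable (\<lambda>n. \<Sum>r\<le>n. norm (f n r))"
  proof (rule summable_comparison_test'[OF summable_mult[OF summable_bailey_weight[OF q AB]]])
    fix n :: nat
    have "(\<Sum>r\<le>n. norm (f n r)) \<le>
        of_nat (card {..n}) * (norm (bailey_weight A B q n) * (K * K) * (4 * (real n + 1)))"
      by (rule sum_bounded_above) (use f_le in auto)
    then show "norm (\<Sum>r\<le>n. norm (f n r)) \<le>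
        4 * K * K * (norm (bailey_weight A B q n) * (real n + 1) ^ 2)"
      by (simp add: sum_nonneg power2_eq_square algebra_simps)
  qed
  then obtain T where T: "(\<lambda>n. \<Sum>r\<le>n. f n r) sums T" "(\<lambda>r. \<Sum>k. f (r + k) r) sums T"
    by (rule triangle_sum_swap)
  have 1: "(\<Sum>r\<le>n. f n r) = bailey_weight A B q n * (-1) ^ n / qpoch (q ^ 2) (q ^ 2) n" for n
    unfolding times_divide_eq_right[symmetric] bailey_pair[OF q q0, of n, symmetric] sum_distrib_left
    by (intro sum.cong) (simp_all add: f_def a_def)
  have 2: "C * (\<Sum>k. f (r + k) r) = bailey_weight A B q r * qpoch_inf (q ^ (r + 2) * A) q *
      qpoch_inf (q ^ (r + 2) * B) q * a r" for r
  proof -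
    have e: "f (r + k) r = bailey_weight A B q (r + k) / (qpoch q q k * qpoch q q (2 * r + k + 1)) * a r" for k
      by (simp add: f_def mult_2 add_ac)
    have "norm (q ^ (r + 2) * B * (A / q ^ r)) < 1"
      using AB q0 by (simp add: power_add power2_eq_square mult_ac)
    then have sm: "summable (\<lambda>k. bailey_weight A B q (r + k) / (qpoch q q k * qpoch q q (2 * r + k + 1)))"
      unfolding bailey_weight_add[OF q0]
      by (intro summable_mult summable_norm_cancel[OF summable_norm_qgauss_term[OF q]])
    show ?thesis
      unfolding e suminf_mult2[OF sm, symmetric] bailey_weight_conjugate[OF q q0 AB] C_def[symmetric]
      using C by simp
  qed
  show ?thesis
  proof (rule that)
    show "(\<lambda>n. bailey_weight A B q n * (-1) ^ n / qpoch (q ^ 2) (q ^ 2) n) sums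
      ((C * T) / (qpoch_inf q q * qpoch_inf (q ^ 2 * A * B) q))"
      using T(1) C unfolding 1 C_def by simp
    show "(\<lambda>r. bailey_weight A B q r * qpoch_inf (q ^ (r + 2) * A) q * qpoch_inf (q ^ (r + 2) * B) q *
      (q ^ (r ^ 2) * (1 - q ^ (2 * r + 1)) * hecke_sum q r)) sums (C * T)"
      using sums_mult[OF T(2), of C] unfolding 2 a_def .
  qed
qed

subsection \<open>Hecke-type double sums\<close>

text \<open>Each parity class of \<open>n + m\<close> is a quadrant in \<open>(r, s)\<close>. The
  reflection \<open>(r, s) \<mapsto> (- 1 - s, - 1 - r)\<close> keeps \<open>r - s\<close> and
  parametrizes the same class by negative pairs, as needed for the second part of
  \<open>dsum_f\<close>.\<close>

lemma wedge_dissection: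
  fixes g :: "nat \<Rightarrow> int \<Rightarrow> complex"
  assumes sm: "summable (\<lambda>n. \<Sum>m\<in>{- int n..int n}. norm (g n m))"
  obtains X Y where
    "((\<lambda>(r, s). g (nat (r + s)) (r - s)) has_sum X) ({0..} \<times> {0..})"
    "((\<lambda>(r, s). g (nat (- 2 - r - s)) (r - s)) has_sum X) ({..<0} \<times> {..<0})"
    "((\<lambda>(r, s). g (nat (r + s + 1)) (r - s)) has_sum Y) ({0..} \<times> {0..})"
    "((\<lambda>(r, s). g (nat (- 1 - r - s)) (r - s)) has_sum Y) ({..<0} \<times> {..<0})"
    "(\<lambda>n. \<Sum>m\<in>{- int n..int n}. g n m) sums (X + Y)"
proof -
  define W where "W = Sigma UNIV (\<lambda>n. {- int n..int n})"
  define E where "E = {(n, m) \<in> W. even (int n + m)}"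
  \<comment> \<open>The strict bounds lose nothing: \<open>|m| = n\<close> makes
    \<open>n + m\<close> even.\<close>
  define D where "D = {(n, m). odd (int n + m) \<and> - int n < m \<and> m < int n}"
  note Sig = sums_Sigma_nat[of "\<lambda>n. {- int n..int n}" g, OF _ sm, simplified, folded W_def]
  note smW = Sig(1)
  have "(\<lambda>(n, m). g n m) summable_on E" "(\<lambda>(n, m). g n m) summable_on D"
    by (rule summable_on_subset[OF smW]; auto simp: E_def D_def W_def)+
  then obtain X Y where X: "((\<lambda>(n, m). g n m) has_sum X) E" and Y: "((\<lambda>(n, m). g n m) has_sum Y) D"
    unfolding summable_on_def by blast
  have "((\<lambda>(n, m). g n m) has_sum (X + Y)) (E \<union> D)"
    by (rule has_sum_Un_disjoint[OF X Y]) (auto simp: E_def D_def)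
  also have "E \<union> D = W"
    unfolding E_def D_def W_def by (auto; presburger)
  finally have XY: "(\<lambda>n. \<Sum>m\<in>{- int n..int n}. g n m) sums (X + Y)"
    by (rule Sig(2))
  have E1: "\<exists>r s. r \<ge> 0 \<and> s \<ge> 0 \<and> b = (nat (r + s), r - s)" if bE: "b \<in> E" for b
  proof -
    obtain n m where b: "b = (n, m)" "even (int n + m)" "- int n \<le> m" "m \<le> int n"
      using bE by (cases b) (auto simp: E_def W_def)
    have "(int n + m) div 2 \<ge> 0" "(int n - m) div 2 \<ge> 0"
      "(int n + m) div 2 + (int n - m) div 2 = int n" "(int n + m) div 2 - (int n - m) div 2 = m"
      using b(2-) by presburger+
    then show ?thesis
      unfolding b(1) by (metis nat_int)
  qed
  have E2: "(nat (r + s), r - s) \<in> E" if "r \<ge> 0" "s \<ge> 0" for r s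
    using that by (auto simp: E_def W_def even_nat_iff)
  have E3: "\<exists>r s. r < 0 \<and> s < 0 \<and> b = (nat (- 2 - r - s), r - s)" if b: "b \<in> E" for b
  proof -
    from E1[OF b] obtain r s where "r \<ge> 0" "s \<ge> 0" "b = (nat (r + s), r - s)"
      by blast
    then show ?thesis
      by (intro exI[of _ "- 1 - s"] exI[of _ "- 1 - r"]) (simp add: add_ac)
  qed
  have E4: "(nat (- 2 - r - s), r - s) \<in> E" if "r < 0" "s < 0" for r s
    using E2[of "- 1 - s" "- 1 - r"] that by (simp add: algebra_simps)
  have D1: "\<exists>r s. r \<ge> 0 \<and> s \<ge> 0 \<and> b = (nat (r + s + 1), r - s)" if bD: "b \<in> D" for b
  proof -
    obtain n m where b: "b = (n, m)" "odd (int n + m)" "- int n < m" "m < int n"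
      using bD by (cases b) (auto simp: D_def)
    have "(int n - 1 + m) div 2 \<ge> 0" "(int n - 1 - m) div 2 \<ge> 0"
      "(int n - 1 + m) div 2 + (int n - 1 - m) div 2 + 1 = int n"
      "(int n - 1 + m) div 2 - (int n - 1 - m) div 2 = m"
      using b(2-) by presburger+
    then show ?thesis
      unfolding b(1) by (metis nat_int)
  qed
  have D2: "(nat (r + s + 1), r - s) \<in> D" if "r \<ge> 0" "s \<ge> 0" for r s
    using that by (auto simp: D_def even_nat_iff)
  have D3: "\<exists>r s. r < 0 \<and> s < 0 \<and> b = (nat (- 1 - r - s), r - s)" if b: "b \<in> D" for b
  proof -
    from D1[OF b] obtain r s where "r \<ge> 0" "s \<ge> 0" "b = (nat (r + s + 1), r - s)"
      by blast
    then show ?thesis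
      by (intro exI[of _ "- 1 - s"] exI[of _ "- 1 - r"]) (simp add: add_ac)
  qed
  have D4: "(nat (- 1 - r - s), r - s) \<in> D" if "r < 0" "s < 0" for r s
    using D2[of "- 1 - s" "- 1 - r"] that by (simp add: algebra_simps)
  show ?thesis
  proof (rule that[OF _ _ _ _ XY])
    show "((\<lambda>(r, s). g (nat (r + s)) (r - s)) has_sum X) ({0..} \<times> {0..})"
      by (rule iffD2[OF has_sum_reindex_bij_witness[where j = "\<lambda>(r, s). (nat (r + s), r - s)" and
          i = "\<lambda>(n, m). ((int n + m) div 2, (int n - m) div 2)" and
          h = "\<lambda>(n, m). g n m" and T = E] X]) (auto intro: E2 dest!: E1)
    show "((\<lambda>(r, s). g (nat (- 2 - r - s)) (r - s)) has_sum X) ({..<0} \<times> {..<0})"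
      by (rule iffD2[OF has_sum_reindex_bij_witness[where j = "\<lambda>(r, s). (nat (- 2 - r - s), r - s)" and
          i = "\<lambda>(n, m). ((m - 2 - int n) div 2, (- m - 2 - int n) div 2)" and
          h = "\<lambda>(n, m). g n m" and T = E] X]) (auto intro: E4 dest!: E3)
    show "((\<lambda>(r, s). g (nat (r + s + 1)) (r - s)) has_sum Y) ({0..} \<times> {0..})"
      by (rule iffD2[OF has_sum_reindex_bij_witness[where j = "\<lambda>(r, s). (nat (r + s + 1), r - s)" and
          i = "\<lambda>(n, m). ((int n - 1 + m) div 2, (int n - 1 - m) div 2)" and
          h = "\<lambda>(n, m). g n m" and T = D] Y]) (auto intro: D2 dest!: D1)
    show "((\<lambda>(r, s). g (nat (- 1 - r - s)) (r - s)) has_sum Y) ({..<0} \<times> {..<0})"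
      by (rule iffD2[OF has_sum_reindex_bij_witness[where j = "\<lambda>(r, s). (nat (- 1 - r - s), r - s)" and
          i = "\<lambda>(n, m). ((m - 1 - int n) div 2, (- m - 1 - int n) div 2)" and
          h = "\<lambda>(n, m). g n m" and T = D] Y]) (auto intro: D4 dest!: D3)
  qed
qed

lemma power_int_minus_one_eq: "(-1 :: complex) powi i = (if even i then 1 else -1)"
  by (simp add: power_int_minus_left)

text \<open>Row \<open>n\<close> has \<open>2 * n + 1\<close> terms of norm at most
  \<open>norm q ^ n\<close>.\<close>

lemma summable_wedge:
  fixes u :: "nat \<Rightarrow> int \<Rightarrow> complex" and e :: "nat \<Rightarrow> int \<Rightarrow> int"
  assumes q: "norm q < 1"
    and u: "\<And>n m. norm (u n m) \<le> 1"
    and e: "\<And>n m. m \<in> {- int n..int n} \<Longrightarrow> e n m \<ge> int n"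
  shows "summable (\<lambda>n. \<Sum>m\<in>{- int n..int n}. norm (u n m * q powi e n m))"
proof (rule summable_comparison_test')
  show "summable (\<lambda>n. 2 * (of_nat (Suc n) * norm q ^ n))"
    using q by (intro summable_mult sums_summable[OF geometric_deriv_sums]) simp
  fix n :: nat
  have "norm (u n m * q powi e n m) \<le> norm q ^ n" if m: "m \<in> {- int n..int n}" for m
  proof -
    obtain k where k: "e n m = int k" "n \<le> k"
      using e[OF m] by (metis nat_int_comparison(3) nonneg_int_cases of_nat_0_le_iff order_trans)
    have "norm (u n m) * norm q ^ k \<le> 1 * norm q ^ n"
      using u q k(2) by (intro mult_mono power_decreasing) auto
    then show ?thesis
      by (simp add: k(1) norm_mult norm_power)
  qed
  then have "(\<Sum>m\<in>{- int n..int n}. norm (u n m * q powi e n m)) \<le>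
      of_nat (card {- int n..int n}) * norm q ^ n"
    by (intro sum_bounded_above)
  also have "\<dots> \<le> 2 * (of_nat (Suc n) * norm q ^ n)"
    unfolding mult.assoc[symmetric] by (intro mult_right_mono) auto
  finally show "norm (\<Sum>m\<in>{- int n..int n}. norm (u n m * q powi e n m)) \<le>
      2 * (of_nat (Suc n) * norm q ^ n)"
    by (simp add: sum_nonneg)
qed

text \<open>With all arguments powers of one \<open>q\<close>, comparing summands reduces to
  comparing integer exponents.\<close>

lemma dsum_term_powi:
  assumes "q \<noteq> 0"
  shows "dsum_term a b c (q powi k) (q powi l) (q powi d) (r, s) = (-1) powi (r + s) *
    q powi (k * r + l * s + d * (a * (r * (r - 1) div 2) + b * r * s + c * (s * (s - 1) div 2)))"
  using assms by (simp add: dsum_term_def power_int_mult power_int_add mult.assoc)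

text \<open>The factor \<open>1 - q ^ (2 * n + 1)\<close> splits the series into \<open>g\<close>
  and \<open>g'\<close>. The even and odd classes of \<open>g\<close> give the nonnegative quadrants
  for \<open>x\<close> and \<open>y\<close>; those of \<open>g'\<close> give the negative quadrants
  in the opposite order. The hypotheses \<open>e1\<close> to \<open>e4\<close> match the exponents
  in these four cases.\<close>

lemma hecke_double_sum:
  fixes e :: "int \<Rightarrow> int \<Rightarrow> int"
  defines "T \<equiv> \<lambda>r. r * (r - 1) div 2"
  assumes q: "norm q < 1" and q0: "q \<noteq> 0"
    and e: "\<And>n m. m \<in> {- int n..int n} \<Longrightarrow> e (int n) m \<ge> int n"
    and xyp: "x = q powi k" "y = q powi l" "p = q powi d"
    and e1: "\<And>r s. k * r + k * s + d * (T r + b * r * s + T s) = e (r + s) (r - s)"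
    and e2: "\<And>r s. k * r + k * s + d * (T r + b * r * s + T s) =
      e (- 1 - r - s) (r - s) + 2 * (- 1 - r - s) + 1"
    and e3: "\<And>r s. int h + (l * r + l * s + d * (T r + b * r * s + T s)) =
      e (r + s + 1) (r - s)"
    and e4: "\<And>r s. int h + (l * r + l * s + d * (T r + b * r * s + T s)) =
      e (- 2 - r - s) (r - s) + 2 * (- 2 - r - s) + 1"
  shows "dsum_converges 1 b 1 x x p" "dsum_converges 1 b 1 y y p"
    and "(\<lambda>n. \<Sum>m\<in>{- int n..int n}. (-1) powi m * (1 - q ^ (2 * n + 1)) * q powi e (int n) m) sums
      (dsum_f 1 b 1 x x p + q ^ h * dsum_f 1 b 1 y y p)"
proof -
  define g where "g n m = (-1) powi m * q powi e (int n) m" for n m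
  define g' where "g' n m = (-1) powi m * q powi (e (int n) m + 2 * int n + 1)" for n m
  have "summable (\<lambda>n. \<Sum>m\<in>{- int n..int n}. norm (g n m))"
    unfolding g_def by (rule summable_wedge[OF q _ e]) (simp_all add: power_int_minus_one_eq)
  then obtain X Y where
    X: "((\<lambda>(r, s). g (nat (r + s)) (r - s)) has_sum X) ({0..} \<times> {0..})" and
    Y: "((\<lambda>(r, s). g (nat (r + s + 1)) (r - s)) has_sum Y) ({0..} \<times> {0..})" and
    XY: "(\<lambda>n. \<Sum>m\<in>{- int n..int n}. g n m) sums (X + Y)"
    by (rule wedge_dissection)
  have "summable (\<lambda>n. \<Sum>m\<in>{- int n..int n}. norm (g' n m))"
    unfolding g'_def
  proof (rule summable_wedge[OF q])
    fix n m assume "m \<in> {- int n..int n}"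
    from e[OF this] show "e (int n) m + 2 * int n + 1 \<ge> int n" by simp
  qed (simp_all add: power_int_minus_one_eq)
  then obtain X' Y' where
    X': "((\<lambda>(r, s). g' (nat (- 2 - r - s)) (r - s)) has_sum X') ({..<0} \<times> {..<0})" and
    Y': "((\<lambda>(r, s). g' (nat (- 1 - r - s)) (r - s)) has_sum Y') ({..<0} \<times> {..<0})" and
    XY': "(\<lambda>n. \<Sum>m\<in>{- int n..int n}. g' n m) sums (X' + Y')"
    by (rule wedge_dissection)
  have sgn: "(-1 :: complex) powi (r + s) = (-1) powi (r - s)" for r s :: int
    by (simp add: power_int_minus_one_eq)
  have t1: "dsum_term 1 b 1 x x p (r, s) =
      (-1) powi (r - s) * q powi (k * r + k * s + d * (T r + b * r * s + T s))" for r s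
    unfolding xyp dsum_term_powi[OF q0] T_def sgn mult_1 ..
  have t2: "q ^ h * dsum_term 1 b 1 y y p (r, s) =
      (-1) powi (r - s) * q powi (int h + (l * r + l * s + d * (T r + b * r * s + T s)))" for r s
    unfolding xyp dsum_term_powi[OF q0] T_def sgn mult_1 power_int_add[OF disjI1[OF q0], of "int h"]
    by simp
  have P1: "(dsum_term 1 b 1 x x p has_sum X) ({0..} \<times> {0..})"
    by (rule iffD1[OF has_sum_cong X]) (auto simp: t1 e1 g_def)
  have P2: "((\<lambda>z. q ^ h * dsum_term 1 b 1 y y p z) has_sum Y) ({0..} \<times> {0..})"
    by (rule iffD1[OF has_sum_cong Y]) (auto simp: t2 e3 g_def)
  have N1: "(dsum_term 1 b 1 x x p has_sum Y') ({..<0} \<times> {..<0})"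
    by (rule iffD1[OF has_sum_cong Y']) (auto simp: t1 e2 g'_def)
  have N2: "((\<lambda>z. q ^ h * dsum_term 1 b 1 y y p z) has_sum X') ({..<0} \<times> {..<0})"
    by (rule iffD1[OF has_sum_cong X']) (auto simp: t2 e4 g'_def)
  have qh: "q ^ h \<noteq> 0"
    using q0 by simp
  have P2': "dsum_term 1 b 1 y y p summable_on ({0..} \<times> {0..})"
    and N2': "dsum_term 1 b 1 y y p summable_on ({..<0} \<times> {..<0})"
    using P2 N2 qh by (auto simp: summable_on_cmult_right' dest!: has_sum_imp_summable)
  show "dsum_converges 1 b 1 x x p" "dsum_converges 1 b 1 y y p"
    using P1 N1 P2' N2' by (auto simp: dsum_converges_def dest: has_sum_imp_summable)
  \<comment> \<open>The classes cross over: the even class of \<open>g'\<close> is subtracted from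
    the odd class of \<open>g\<close>, and conversely in \<open>F1\<close>.\<close>
  have F2: "q ^ h * dsum_f 1 b 1 y y p = Y - X'"
    unfolding dsum_f_def right_diff_distrib using infsumI[OF P2] infsumI[OF N2]
    by (simp add: infsum_cmult_right')
  have F1: "dsum_f 1 b 1 x x p = X - Y'"
    unfolding dsum_f_def using infsumI[OF P1] infsumI[OF N1] by simp
  have F3: "(\<Sum>m\<in>{- int n..int n}. (-1) powi m * (1 - q ^ (2 * n + 1)) * q powi e (int n) m) =
      (\<Sum>m\<in>{- int n..int n}. g n m) - (\<Sum>m\<in>{- int n..int n}. g' n m)" for n
  proof -
    have "q powi (e (int n) m + 2 * int n + 1) = q powi e (int n) m * q ^ (2 * n + 1)" for m
      using power_int_add[OF disjI1[OF q0], of "e (int n) m" "int (2 * n + 1)"]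
      unfolding power_int_of_nat by (simp add: add_ac)
    then show ?thesis
      unfolding g_def g'_def sum_subtractf[symmetric] by (intro sum.cong) (auto simp: algebra_simps)
  qed
  have "X + Y - (X' + Y') = X - Y' + (Y - X')"
    by simp
  with sums_diff[OF XY XY'] show "(\<lambda>n. \<Sum>m\<in>{- int n..int n}. (-1) powi m * (1 - q ^ (2 * n + 1)) * q powi e (int n) m) sums
      (dsum_f 1 b 1 x x p + q ^ h * dsum_f 1 b 1 y y p)"
    unfolding F1 F2 F3 by simp
qed

lemma int_square_le:
  assumes "m \<in> {- int n..int n}"
  shows "m ^ 2 \<le> int n ^ 2"
  using assms by (intro power2_le_iff_abs_le[THEN iffD2]) auto

lemma hecke_double_sum_131:
  assumes q: "norm q < 1" and q0: "q \<noteq> 0"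
  shows "dsum_converges 1 3 1 (q^2) (q^2) (q^2)" "dsum_converges 1 3 1 (q^6) (q^6) (q^2)"
    and "(\<lambda>n. \<Sum>m\<in>{- int n..int n}. (-1) powi m * (1 - q ^ (2 * n + 1)) *
        q powi (2 * int n ^ 2 + int n - m ^ 2)) sums
      (dsum_f 1 3 1 (q^2) (q^2) (q^2) + q ^ 3 * dsum_f 1 3 1 (q^6) (q^6) (q^2))"
proof -
  have e: "2 * int n ^ 2 + int n - m ^ 2 \<ge> int n" if "m \<in> {- int n..int n}" for n m
    using int_square_le[OF that] zero_le_power2[of "int n"] by linarith
  \<comment> \<open>Only \<open>2 * T r = r * (r - 1)\<close> is used below, so the exponent
    identities become polynomial.\<close>
  define T where "T r = r * (r - 1) div 2" for r :: int
  have T: "2 * T r = r * (r - 1)" for r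
    by (simp add: T_def)
  have e1: "2 * r + 2 * s + 2 * (T r + 3 * r * s + T s) = 2 * (r + s) ^ 2 + (r + s) - (r - s) ^ 2" for r s
    using T[of r] T[of s] by algebra
  have e2: "2 * r + 2 * s + 2 * (T r + 3 * r * s + T s) =
      2 * (- 1 - r - s) ^ 2 + (- 1 - r - s) - (r - s) ^ 2 + 2 * (- 1 - r - s) + 1" for r s
    using T[of r] T[of s] by algebra
  have e3: "int 3 + (6 * r + 6 * s + 2 * (T r + 3 * r * s + T s)) =
      2 * (r + s + 1) ^ 2 + (r + s + 1) - (r - s) ^ 2" for r s
    unfolding of_nat_numeral using T[of r] T[of s] by algebra
  have e4: "int 3 + (6 * r + 6 * s + 2 * (T r + 3 * r * s + T s)) =
      2 * (- 2 - r - s) ^ 2 + (- 2 - r - s) - (r - s) ^ 2 + 2 * (- 2 - r - s) + 1" for r s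
    unfolding of_nat_numeral using T[of r] T[of s] by algebra
  have "q ^ 2 = q powi 2" "q ^ 6 = q powi 6"
    by simp_all
  \<comment> \<open>The base \<open>q ^ 2\<close> equals the first argument, so the first equation
    serves for both.\<close>
  note * = hecke_double_sum[where e = "\<lambda>n m. 2 * n ^ 2 + n - m ^ 2", folded T_def,
      OF q q0 e this(1,2,1) e1 e2 e3 e4]
  show "dsum_converges 1 3 1 (q^2) (q^2) (q^2)" "dsum_converges 1 3 1 (q^6) (q^6) (q^2)"
    "(\<lambda>n. \<Sum>m\<in>{- int n..int n}. (-1) powi m * (1 - q ^ (2 * n + 1)) *
        q powi (2 * int n ^ 2 + int n - m ^ 2)) sums
      (dsum_f 1 3 1 (q^2) (q^2) (q^2) + q ^ 3 * dsum_f 1 3 1 (q^6) (q^6) (q^2))"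
    by (rule *; assumption)+
qed

lemma hecke_double_sum_151:
  assumes q: "norm q < 1" and q0: "q \<noteq> 0"
  shows "dsum_converges 1 5 1 q q q" "dsum_converges 1 5 1 (q^4) (q^4) q"
    and "(\<lambda>n. \<Sum>m\<in>{- int n..int n}. (-1) powi m * (1 - q ^ (2 * n + 1)) *
        q powi ((3 * int n ^ 2 + int n) div 2 - m ^ 2)) sums
      (dsum_f 1 5 1 q q q + q ^ 2 * dsum_f 1 5 1 (q^4) (q^4) q)"
proof -
  have e: "(3 * int n ^ 2 + int n) div 2 - m ^ 2 \<ge> int n" if "m \<in> {- int n..int n}" for n m
  proof -
    have "int n \<le> int n ^ 2"
      by (cases n) (auto simp: power2_eq_square algebra_simps)
    then show ?thesis
      using int_square_le[OF that] by linarith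
  qed
  define T where "T r = r * (r - 1) div 2" for r :: int
  have T: "2 * T r = r * (r - 1)" for r
    by (simp add: T_def)
  \<comment> \<open>The doubled equation already exhibits \<open>A\<close> as even, so the division
    is exact.\<close>
  have div2: "z = A div 2 - B + C" if "2 * z = A - 2 * B + 2 * C" for z A B C :: int
    using that by simp
  have e1: "1 * r + 1 * s + 1 * (T r + 5 * r * s + T s) =
      (3 * (r + s) ^ 2 + (r + s)) div 2 - (r - s) ^ 2" for r s
    by (rule div2[where C = 0, simplified]) (use T[of r] T[of s] in algebra)
  have e2: "1 * r + 1 * s + 1 * (T r + 5 * r * s + T s) =
      (3 * (- 1 - r - s) ^ 2 + (- 1 - r - s)) div 2 - (r - s) ^ 2 + 2 * (- 1 - r - s) + 1" for r s
    unfolding add.assoc[of _ "2 * _" 1] by (rule div2) (use T[of r] T[of s] in algebra)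
  have e3: "int 2 + (4 * r + 4 * s + 1 * (T r + 5 * r * s + T s)) =
      (3 * (r + s + 1) ^ 2 + (r + s + 1)) div 2 - (r - s) ^ 2" for r s
    unfolding of_nat_numeral
    by (rule div2[where C = 0, simplified]) (use T[of r] T[of s] in algebra)
  have e4: "int 2 + (4 * r + 4 * s + 1 * (T r + 5 * r * s + T s)) =
      (3 * (- 2 - r - s) ^ 2 + (- 2 - r - s)) div 2 - (r - s) ^ 2 + 2 * (- 2 - r - s) + 1" for r s
    unfolding of_nat_numeral add.assoc[of _ "2 * _" 1]
    by (rule div2) (use T[of r] T[of s] in algebra)
  have "q = q powi 1" "q ^ 4 = q powi 4"
    by simp_all
  note * = hecke_double_sum[where e = "\<lambda>n m. (3 * n ^ 2 + n) div 2 - m ^ 2", folded T_def,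
      OF q q0 e this(1,2,1) e1 e2 e3 e4]
  show "dsum_converges 1 5 1 q q q" "dsum_converges 1 5 1 (q^4) (q^4) q"
    "(\<lambda>n. \<Sum>m\<in>{- int n..int n}. (-1) powi m * (1 - q ^ (2 * n + 1)) *
        q powi ((3 * int n ^ 2 + int n) div 2 - m ^ 2)) sums
      (dsum_f 1 5 1 q q q + q ^ 2 * dsum_f 1 5 1 (q^4) (q^4) q)"
    by (rule *; assumption)+
qed

text \<open>The sign \<open>(-1) powi (n + m)\<close> is constant on each parity class, so the even
  class is the nonnegative quadrant and the odd class minus the negative one. The signs inside
  \<open>dsum_term\<close> cancel against those of \<open>- q\<close>.\<close>

lemma hecke_double_sum_010:
  assumes q: "norm q < 1" and q0: "q \<noteq> 0"
  shows "dsum_converges 0 1 0 (- q) (- q) (q^4)"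
    and "(\<lambda>n. \<Sum>m\<in>{- int n..int n}. (-1) powi (int n + m) * q powi (int n ^ 2 + int n - m ^ 2)) sums
      dsum_f 0 1 0 (- q) (- q) (q^4)"
proof -
  define g where "g n m = (-1) powi (int n + m) * q powi (int n ^ 2 + int n - m ^ 2)" for n m
  have "summable (\<lambda>n. \<Sum>m\<in>{- int n..int n}. norm (g n m))"
    unfolding g_def
  proof (rule summable_wedge[OF q])
    fix n m assume "m \<in> {- int n..int n}"
    from int_square_le[OF this] show "int n ^ 2 + int n - m ^ 2 \<ge> int n" by simp
  qed (simp_all add: power_int_minus_one_eq)
  then obtain X Y where
    X: "((\<lambda>(r, s). g (nat (r + s)) (r - s)) has_sum X) ({0..} \<times> {0..})" and
    Y: "((\<lambda>(r, s). g (nat (- 1 - r - s)) (r - s)) has_sum Y) ({..<0} \<times> {..<0})" and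
    XY: "(\<lambda>n. \<Sum>m\<in>{- int n..int n}. g n m) sums (X + Y)"
    by (rule wedge_dissection)
  have t: "dsum_term 0 1 0 (- q) (- q) (q^4) (r, s) = q powi (r + s + 4 * r * s)" for r s
  proof -
    have "(- q) powi i = (-1) powi i * q powi i" for i
      using power_int_mult_distrib[of "-1" q i] by simp
    moreover have "(q ^ 4) powi i = q powi (4 * i)" for i
      by (simp add: power_int_mult)
    ultimately show ?thesis
      using q0 by (simp add: dsum_term_def power_int_add power_int_minus_one_eq mult.assoc)
  qed
  have P: "(dsum_term 0 1 0 (- q) (- q) (q^4) has_sum X) ({0..} \<times> {0..})"
  proof (rule iffD1[OF has_sum_cong X], clarify)
    fix r s :: int assume "0 \<le> r" "0 \<le> s"
    then have "int (nat (r + s)) = r + s" by simp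
    moreover have "(r + s) ^ 2 + (r + s) - (r - s) ^ 2 = r + s + 4 * r * s"
      by algebra
    moreover have "even (r + s + (r - s))" by simp
    ultimately show "g (nat (r + s)) (r - s) = dsum_term 0 1 0 (- q) (- q) (q^4) (r, s)"
      unfolding t g_def power_int_minus_one_eq by (simp only: if_True if_False mult_1 mult_minus1)
  qed
  have "((\<lambda>z. - dsum_term 0 1 0 (- q) (- q) (q^4) z) has_sum Y) ({..<0} \<times> {..<0})"
  proof (rule iffD1[OF has_sum_cong Y], clarify)
    fix r s :: int assume "r < 0" "s < 0"
    then have "int (nat (- 1 - r - s)) = - 1 - r - s" by simp
    moreover have "(- 1 - r - s) ^ 2 + (- 1 - r - s) - (r - s) ^ 2 = r + s + 4 * r * s"
      by algebra
    moreover have "odd (- 1 - r - s + (r - s))" by simp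
    ultimately show "g (nat (- 1 - r - s)) (r - s) = - dsum_term 0 1 0 (- q) (- q) (q^4) (r, s)"
      unfolding t g_def power_int_minus_one_eq by (simp only: if_True if_False mult_1 mult_minus1)
  qed
  then have N: "(dsum_term 0 1 0 (- q) (- q) (q^4) has_sum - Y) ({..<0} \<times> {..<0})"
    by (simp only: has_sum_uminus)
  show "dsum_converges 0 1 0 (- q) (- q) (q^4)"
    using P N by (auto simp: dsum_converges_def dest: has_sum_imp_summable)
  have "dsum_f 0 1 0 (- q) (- q) (q^4) = X + Y"
    unfolding dsum_f_def infsumI[OF P] infsumI[OF N] by simp
  then show "(\<lambda>n. \<Sum>m\<in>{- int n..int n}. (-1) powi (int n + m) * q powi (int n ^ 2 + int n - m ^ 2)) sums
      dsum_f 0 1 0 (- q) (- q) (q^4)"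
    using XY by (simp add: g_def)
qed

subsection \<open>Theta constants and single sums\<close>

text \<open>The three products in \<open>theta_j\<close> are the residue classes modulo 3 of a
  single product.\<close>

lemma eta_J_eq:
  assumes q: "norm q < 1" and q0: "q \<noteq> 0" and m: "m > 0"
  shows "eta_J m q = qpoch_inf (q ^ m) (q ^ m)"
proof -
  have qm: "norm (q ^ m) < 1"
    using q m by (simp add: norm_power power_less_one_iff)
  have "q ^ (3 * m) = (q ^ m) ^ 3"
    by (simp add: power_mult[symmetric] mult.commute)
  moreover have "(q ^ m) ^ 3 / q ^ m = (q ^ m) ^ 2"
    using q0 by (simp add: power3_eq_cube power2_eq_square)
  ultimately show ?thesis
    using qpoch_inf_dissect[OF qm, of 3 "q ^ m"]
    by (simp add: eta_J_def theta_J_def theta_j_def eval_nat_numeral mult_ac)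
qed

lemma theta_J_1_2:
  assumes "q \<noteq> 0"
  shows "theta_J 1 2 q = qpoch_inf q (q ^ 2) ^ 2 * qpoch_inf (q ^ 2) (q ^ 2)"
  using assms by (simp add: theta_J_def theta_j_def power2_eq_square)

text \<open>The q-binomial theorem in base \<open>q ^ 2\<close>: the q-Gauss sum with
  \<open>c = 0\<close>, \<open>A = 1 / q\<close>, \<open>z = q ^ 2\<close>.\<close>

lemma qbinomial_odd_sums:
  assumes q: "norm q < 1" and q0: "q \<noteq> 0"
  shows "(\<lambda>n. qpoch q (q ^ 2) n * q ^ n / qpoch (q ^ 2) (q ^ 2) n) sums
    (qpoch_inf (q ^ 2) (q ^ 2) / qpoch_inf q (q ^ 2))"
proof -
  have q2: "norm (q ^ 2) < 1"
    using q by (simp add: norm_power power_less_one_iff)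
  have zA: "q ^ 2 * (1 / q) = q"
    using q0 by (simp add: power2_eq_square)
  have zA_less: "norm (q ^ 2 * (1 / q)) < 1"
    unfolding zA by (rule q)
  have "qgauss_term (1 / q) (q ^ 2) 0 (q ^ 2) n = qpoch q (q ^ 2) n * q ^ n / qpoch (q ^ 2) (q ^ 2) n" for n
  proof (induction n)
    case (Suc n)
    have "(1 / q - (q ^ 2) ^ n) * (q ^ 2 - 0 * (q ^ 2) ^ n) = (1 - (q ^ 2) ^ n * q) * q"
      using q0 by (simp add: divide_simps) (simp add: power2_eq_square algebra_simps)
    then show ?case
      unfolding qgauss_term_Suc Suc qpoch_Suc by (simp only: power_Suc2 mult_zero_left diff_zero mult_1 times_divide_times_eq mult_ac)
  qed (simp add: qgauss_term_def)
  then show ?thesis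
    using summable_sums[OF summable_norm_cancel[OF summable_norm_qgauss_term[OF q2 zA_less]], of 0]
      qgauss_sum[OF q2 zA_less, of 0] q2
    unfolding zA by (simp add: qpoch_inf_zero)
qed

text \<open>Euler's expansion, the q-Gauss sum with \<open>A = c = 0\<close> and
  \<open>z = q\<close>. It evaluates the third single sum, and the second in base
  \<open>q ^ 2\<close>.\<close>

lemma euler_sums:
  assumes q: "norm q < 1"
  shows "(\<lambda>n. (-1) ^ n * q ^ (n * (n + 1) div 2) / qpoch q q n) sums qpoch_inf q q"
proof -
  have z: "norm (q * 0) < 1" by simp
  have "qgauss_term 0 q 0 q n = (-1) ^ n * q ^ (n * (n + 1) div 2) / qpoch q q n" for n
  proof (induction n)
    case (Suc n)
    have "Suc n * (Suc n + 1) div 2 = n * (n + 1) div 2 + Suc n"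
      by simp
    then show ?case
      unfolding qgauss_term_Suc Suc qpoch_Suc by (simp add: power_add mult_ac)
  qed (simp add: qgauss_term_def)
  then show ?thesis
    using summable_sums[OF summable_norm_cancel[OF summable_norm_qgauss_term[OF q z]], of 0]
      qgauss_sum[OF q z, of 0] q
    by (simp add: qpoch_inf_zero)
qed

subsection \<open>The three cases of Bailey's lemma\<close>

context
  fixes q :: complex
  assumes q: "norm q < 1" and q0: "q \<noteq> 0"
begin

lemma hecke_sum_times_power:
  assumes "\<And>m. e m = int k - m ^ 2"
  shows "(\<Sum>m\<in>{- int n..int n}. (-1) powi m * c * q powi e m) = q ^ k * c * hecke_sum q n"
proof -
  have "q powi e m = q ^ k * q powi (- (m ^ 2))" for m
    using q0 by (simp add: assms power_int_diff power_int_minus divide_inverse)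
  then show ?thesis
    unfolding hecke_sum_def sum_distrib_left by (intro sum.cong) (simp_all add: mult_ac)
qed

lemma bailey_weight_00: "bailey_weight 0 0 q n = q ^ (n ^ 2 + n)"
  by (induction n) (simp_all add: bailey_weight_def power2_eq_square power_add mult_ac)

text \<open>For \<open>A = B = 0\<close> the infinite products in the summands are 1, and the weight
  adds \<open>n ^ 2 + n\<close> to the exponent \<open>n ^ 2\<close>.\<close>

lemma bailey_00:
  obtains S where "(\<lambda>n. (-1) ^ n * q ^ (n ^ 2 + n) / qpoch (q ^ 2) (q ^ 2) n) sums (S / qpoch_inf q q)"
    "(\<lambda>n. \<Sum>m\<in>{- int n..int n}. (-1) powi m * (1 - q ^ (2 * n + 1)) *
        q powi (2 * int n ^ 2 + int n - m ^ 2)) sums S"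
proof -
  have e: "2 * int n ^ 2 + int n - m ^ 2 = int (n ^ 2 + n + n ^ 2) - m ^ 2" for n m
    by simp
  have "norm (q ^ 2 * 0 * 0) < 1" by simp
  from bailey_transform[OF q q0 this] obtain S where
    "(\<lambda>n. bailey_weight 0 0 q n * (-1) ^ n / qpoch (q ^ 2) (q ^ 2) n) sums
      (S / (qpoch_inf q q * qpoch_inf (q ^ 2 * 0 * 0) q))"
    "(\<lambda>r. bailey_weight 0 0 q r * qpoch_inf (q ^ (r + 2) * 0) q * qpoch_inf (q ^ (r + 2) * 0) q *
      (q ^ (r ^ 2) * (1 - q ^ (2 * r + 1)) * hecke_sum q r)) sums S" .
  then show ?thesis
    by (intro that[of S]; unfold hecke_sum_times_power[OF e] bailey_weight_00 mult_zero_right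
        qpoch_inf_zero[OF q] mult_1_right power_add[of q "_ ^ 2 + _"])
      (simp_all only: mult_ac)
qed

lemma bailey_weight_01: "bailey_weight 0 (- 1 / q) q n = q ^ (n * (n + 1) div 2) * qpoch (- q) q n"
proof (induction n)
  case (Suc n)
  have "(0 - q ^ n) * (- 1 / q - q ^ n) * q ^ 2 = q ^ Suc n * (1 - q ^ n * (- q))"
    using q0 by (simp add: divide_simps) (simp add: power2_eq_square algebra_simps)
  moreover have "Suc n * (Suc n + 1) div 2 = n * (n + 1) div 2 + Suc n"
    by simp
  ultimately show ?case
    unfolding bailey_weight_Suc Suc qpoch_Suc by (simp only: power_add mult_ac)
qed (simp add: bailey_weight_def)

text \<open>For \<open>A = 0\<close>, \<open>B = - 1 / q\<close> the weight contains
  \<open>qpoch (- q) q n\<close>. It reduces \<open>qpoch (q ^ 2) (q ^ 2) n\<close> to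
  \<open>qpoch q q n\<close> on one side and completes the constant \<open>qpoch_inf (- q) q\<close>
  on the other.\<close>

lemma bailey_01:
  obtains S where "(\<lambda>n. (-1) ^ n * q ^ (n * (n + 1) div 2) / qpoch q q n) sums
      (qpoch_inf (- q) q / qpoch_inf q q * S)"
    "(\<lambda>n. \<Sum>m\<in>{- int n..int n}. (-1) powi m * (1 - q ^ (2 * n + 1)) *
        q powi ((3 * int n ^ 2 + int n) div 2 - m ^ 2)) sums S"
proof -
  have e: "(3 * int n ^ 2 + int n) div 2 - m ^ 2 = int (n * (n + 1) div 2 + n ^ 2) - m ^ 2" for n m
  proof -
    have "3 * int n ^ 2 + int n = int (n * (n + 1)) + int (n ^ 2) * 2"
      by (simp add: power2_eq_square algebra_simps)
    then have "(3 * int n ^ 2 + int n) div 2 = int (n * (n + 1)) div 2 + int (n ^ 2)"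
      by simp
    then show ?thesis
      by (simp only: zdiv_int of_nat_add of_nat_numeral)
  qed
  have nz: "q ^ i * (- q) \<noteq> 1" for i
    by (rule power_mult_neq_one) (use q in auto)
  have N: "qpoch_inf (- q) q \<noteq> 0"
    by (rule qpoch_inf_nonzero[OF q nz])
  have "norm (q ^ 2 * 0 * (- 1 / q)) < 1" by simp
  from bailey_transform[OF q q0 this] obtain S where
    S: "(\<lambda>n. bailey_weight 0 (- 1 / q) q n * (-1) ^ n / qpoch (q ^ 2) (q ^ 2) n) sums
      (S / (qpoch_inf q q * qpoch_inf (q ^ 2 * 0 * (- 1 / q)) q))"
    "(\<lambda>r. bailey_weight 0 (- 1 / q) q r * qpoch_inf (q ^ (r + 2) * 0) q *
      qpoch_inf (q ^ (r + 2) * (- 1 / q)) q *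
      (q ^ (r ^ 2) * (1 - q ^ (2 * r + 1)) * hecke_sum q r)) sums S" .
  have "qpoch (- q) q n \<noteq> 0" for n
    by (rule qpoch_nonzero[OF nz])
  then have 1: "bailey_weight 0 (- 1 / q) q n * (-1) ^ n / qpoch (q ^ 2) (q ^ 2) n =
      (-1) ^ n * q ^ (n * (n + 1) div 2) / qpoch q q n" for n
    unfolding bailey_weight_01 qpoch_mult_minus[symmetric] by simp
  have 2: "bailey_weight 0 (- 1 / q) q r * qpoch_inf (q ^ (r + 2) * 0) q *
      qpoch_inf (q ^ (r + 2) * (- 1 / q)) q *
      (q ^ (r ^ 2) * (1 - q ^ (2 * r + 1)) * hecke_sum q r) =
      qpoch_inf (- q) q * (\<Sum>m\<in>{- int r..int r}. (-1) powi m * (1 - q ^ (2 * r + 1)) *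
        q powi ((3 * int r ^ 2 + int r) div 2 - m ^ 2))" for r
  proof -
    have "q ^ (r + 2) * (- 1 / q) = q ^ r * (- q)"
      using q0 by (simp add: power_add power2_eq_square)
    then show ?thesis
      unfolding hecke_sum_times_power[OF e] bailey_weight_01 qpoch_inf_shift[OF q, of "- q" r] power_add[of q "_ div 2"]
      by (simp add: qpoch_inf_zero[OF q])
  qed
  show ?thesis
  \<comment> \<open>The witness is the old \<open>S\<close> divided by the constant which fact 2
    pulls out of every term.\<close>
  proof (rule that)
    show "(\<lambda>n. (-1) ^ n * q ^ (n * (n + 1) div 2) / qpoch q q n) sums
        (qpoch_inf (- q) q / qpoch_inf q q * (S / qpoch_inf (- q) q))"
      using S(1) N unfolding 1 by (simp add: qpoch_inf_zero[OF q])
    show "(\<lambda>n. \<Sum>m\<in>{- int n..int n}. (-1) powi m * (1 - q ^ (2 * n + 1)) *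
        q powi ((3 * int n ^ 2 + int n) div 2 - m ^ 2)) sums (S / qpoch_inf (- q) q)"
      using sums_divide[OF S(2), of "qpoch_inf (- q) q"] N unfolding 2 by simp
  qed
qed

text \<open>The opposite parameters multiply to an expression in \<open>p ^ 2\<close>, so the root
  disappears and the base becomes \<open>q ^ 2\<close>.\<close>

lemma bailey_weight_sqrt:
  assumes p: "p ^ 2 = q"
  shows "bailey_weight (1 / p) (- (1 / p)) q n = (- q) ^ n * qpoch q (q ^ 2) n"
proof (induction n)
  case (Suc n)
  have "p \<noteq> 0"
    using p q0 by auto
  then have "(1 / p - q ^ n) * (- (1 / p) - q ^ n) * p ^ 2 = - (1 - (q ^ n) ^ 2 * p ^ 2)"
    by (simp add: field_simps power2_eq_square)
  then have "(1 / p - q ^ n) * (- (1 / p) - q ^ n) * q ^ 2 = (- q) * (1 - (q ^ 2) ^ n * q)"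
    unfolding p by (simp add: power2_eq_square power_mult_distrib algebra_simps)
  then show ?case
    unfolding bailey_weight_Suc Suc qpoch_Suc by (simp only: power_Suc mult_ac)
qed (simp add: bailey_weight_def)

lemma bailey_sqrt:
  obtains S where "(\<lambda>n. qpoch q (q ^ 2) n * q ^ n / qpoch (q ^ 2) (q ^ 2) n) sums
      (qpoch_inf q (q ^ 2) / qpoch_inf (q ^ 2) (q ^ 2) * S)"
    "(\<lambda>n. \<Sum>m\<in>{- int n..int n}. (-1) powi (int n + m) * q powi (int n ^ 2 + int n - m ^ 2)) sums S"
proof -
  define p where "p = csqrt q"
  have p: "p ^ 2 = q"
    by (simp add: p_def)
  have p0: "p \<noteq> 0"
    using p q0 by auto
  define V where "V = qpoch_inf q (q ^ 2)"
  have q2: "norm (q ^ 2) < 1"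
    using q by (simp add: norm_power power_less_one_iff)
  have V: "V \<noteq> 0"
    unfolding V_def by (rule qpoch_inf_nonzero[OF q2 power_mult_neq_one[OF q2 q]])
  have AB: "q ^ 2 * (1 / p) * (- (1 / p)) = - q"
  proof -
    have "q ^ 2 * (1 / p) * (- (1 / p)) = - (q ^ 2 / p ^ 2)"
      by (simp add: power2_eq_square)
    then show ?thesis
      using q0 unfolding p by (simp add: power2_eq_square)
  qed
  have "norm (q ^ 2 * (1 / p) * (- (1 / p))) < 1"
    unfolding AB using q by simp
  from bailey_transform[OF q q0 this] obtain S where
    S: "(\<lambda>n. bailey_weight (1 / p) (- (1 / p)) q n * (-1) ^ n / qpoch (q ^ 2) (q ^ 2) n) sums
      (S / (qpoch_inf q q * qpoch_inf (- q) q))"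
    "(\<lambda>r. bailey_weight (1 / p) (- (1 / p)) q r * qpoch_inf (q ^ (r + 2) * (1 / p)) q *
      qpoch_inf (q ^ (r + 2) * (- (1 / p))) q *
      (q ^ (r ^ 2) * (1 - q ^ (2 * r + 1)) * hecke_sum q r)) sums S"
    unfolding AB .
  have 1: "bailey_weight (1 / p) (- (1 / p)) q n * (-1) ^ n / qpoch (q ^ 2) (q ^ 2) n =
      qpoch q (q ^ 2) n * q ^ n / qpoch (q ^ 2) (q ^ 2) n" for n
  proof -
    have "(- q) ^ n * (-1) ^ n = q ^ n"
      by (simp add: power_mult_distrib[symmetric])
    then show ?thesis
      unfolding bailey_weight_sqrt[OF p] by (simp add: mult_ac)
  qed
  have 2: "bailey_weight (1 / p) (- (1 / p)) q r * qpoch_inf (q ^ (r + 2) * (1 / p)) q *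
      qpoch_inf (q ^ (r + 2) * (- (1 / p))) q *
      (q ^ (r ^ 2) * (1 - q ^ (2 * r + 1)) * hecke_sum q r) =
      V * (\<Sum>m\<in>{- int r..int r}. (-1) powi (int r + m) * q powi (int r ^ 2 + int r - m ^ 2))" for r
  proof -
    have "(q ^ (r + 2) * (1 / p)) ^ 2 = (q ^ (r + 2)) ^ 2 / q"
      by (simp add: p power_mult_distrib power_divide)
    also have "\<dots> = (q ^ 2) ^ Suc r * q"
      using q0 by (simp add: power_add power2_eq_square power_mult_distrib mult_ac)
    finally have "qpoch_inf (q ^ (r + 2) * (1 / p)) q * qpoch_inf (q ^ (r + 2) * (- (1 / p))) q =
        qpoch_inf ((q ^ 2) ^ Suc r * q) (q ^ 2)"
      using qpoch_inf_mult_minus[OF q, of "q ^ (r + 2) * (1 / p)"] by simp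
    \<comment> \<open>The factor \<open>1 - q ^ (2 * r + 1)\<close> fills the gap between the finite
      and the infinite product, which is why it is absent from the first chain.\<close>
    moreover have "V = qpoch q (q ^ 2) r * (1 - q ^ (2 * r + 1)) * qpoch_inf ((q ^ 2) ^ Suc r * q) (q ^ 2)"
      unfolding V_def qpoch_inf_shift[OF q2, of q "Suc r"] qpoch_Suc by (simp add: power_mult[symmetric] mult.commute)
    moreover have "(\<Sum>m\<in>{- int r..int r}. (-1) powi (int r + m) * q powi (int r ^ 2 + int r - m ^ 2)) =
        (-1) ^ r * (q ^ (r ^ 2 + r) * 1 * hecke_sum q r)"
    proof -
      have "int r ^ 2 + int r - m ^ 2 = int (r ^ 2 + r) - m ^ 2" for m
        by simp
      from hecke_sum_times_power[OF this, of 1 r, symmetric] show ?thesis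
        by (simp add: sum_distrib_left power_int_add mult.assoc)
    qed
    moreover have "(- q) ^ r = (-1) ^ r * q ^ r"
      by (rule power_minus)
    ultimately show ?thesis
      unfolding bailey_weight_sqrt[OF p] by (simp only: power_add mult_1 mult_ac)
  qed
  show ?thesis
  proof (rule that)
    show "(\<lambda>n. qpoch q (q ^ 2) n * q ^ n / qpoch (q ^ 2) (q ^ 2) n) sums
      (qpoch_inf q (q ^ 2) / qpoch_inf (q ^ 2) (q ^ 2) * (S / V))"
      using S(1) V unfolding 1 qpoch_inf_mult_minus[OF q] V_def[symmetric] by simp
    show "(\<lambda>n. \<Sum>m\<in>{- int n..int n}. (-1) powi (int n + m) * q powi (int n ^ 2 + int n - m ^ 2)) sums (S / V)"
      using sums_divide[OF S(2), of V] V unfolding 2 by simp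
  qed
qed

end

section \<open>Assembly of the three chains\<close>

theorem theorem2p5:
  fixes q :: complex
  assumes "0 < norm q" and "norm q < 1"
  shows
    "(summable (\<lambda>n. qpoch q (q^2) n * q ^ n / qpoch (q^2) (q^2) n) \<and>
     summable (\<lambda>n. \<Sum>m\<in>{- int n..int n}. (-1) powi (int n + m) * q powi (int n ^ 2 + int n - m ^ 2)) \<and>
     dsum_converges 0 1 0 (- q) (- q) (q^4) \<and>
     (\<Sum>n. qpoch q (q^2) n * q ^ n / qpoch (q^2) (q^2) n)
       = qpoch_inf q (q^2) / qpoch_inf (q^2) (q^2) *
         (\<Sum>n. \<Sum>m\<in>{- int n..int n}. (-1) powi (int n + m) * q powi (int n ^ 2 + int n - m ^ 2)) \<and>
     qpoch_inf q (q^2) / qpoch_inf (q^2) (q^2) *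
         (\<Sum>n. \<Sum>m\<in>{- int n..int n}. (-1) powi (int n + m) * q powi (int n ^ 2 + int n - m ^ 2))
       = qpoch_inf q (q^2) / qpoch_inf (q^2) (q^2) * dsum_f 0 1 0 (- q) (- q) (q^4) \<and>
     qpoch_inf q (q^2) / qpoch_inf (q^2) (q^2) * dsum_f 0 1 0 (- q) (- q) (q^4)
       = eta_J 2 q ^ 2 / eta_J 1 q) \<and>
    (summable (\<lambda>n. (-1) ^ n * q ^ (n ^ 2 + n) / qpoch (q^2) (q^2) n) \<and>
     summable (\<lambda>n. \<Sum>m\<in>{- int n..int n}. (-1) powi m * (1 - q ^ (2 * n + 1)) * q powi (2 * int n ^ 2 + int n - m ^ 2)) \<and>
     dsum_converges 1 3 1 (q^2) (q^2) (q^2) \<and>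
     dsum_converges 1 3 1 (q^6) (q^6) (q^2) \<and>
     (\<Sum>n. (-1) ^ n * q ^ (n ^ 2 + n) / qpoch (q^2) (q^2) n)
       = 1 / qpoch_inf q q *
         (\<Sum>n. \<Sum>m\<in>{- int n..int n}. (-1) powi m * (1 - q ^ (2 * n + 1)) * q powi (2 * int n ^ 2 + int n - m ^ 2)) \<and>
     1 / qpoch_inf q q *
         (\<Sum>n. \<Sum>m\<in>{- int n..int n}. (-1) powi m * (1 - q ^ (2 * n + 1)) * q powi (2 * int n ^ 2 + int n - m ^ 2))
       = 1 / qpoch_inf q q * (dsum_f 1 3 1 (q^2) (q^2) (q^2) + q ^ 3 * dsum_f 1 3 1 (q^6) (q^6) (q^2)) \<and>
     1 / qpoch_inf q q * (dsum_f 1 3 1 (q^2) (q^2) (q^2) + q ^ 3 * dsum_f 1 3 1 (q^6) (q^6) (q^2))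
       = eta_J 1 q * eta_J 2 q / qpoch_inf q q \<and>
     eta_J 1 q * eta_J 2 q / qpoch_inf q q
       = eta_J 2 q) \<and>
    (summable (\<lambda>n. (-1) ^ n * q ^ (n * (n + 1) div 2) / qpoch q q n) \<and>
     summable (\<lambda>n. \<Sum>m\<in>{- int n..int n}. (-1) powi m * (1 - q ^ (2 * n + 1)) * q powi ((3 * int n ^ 2 + int n) div 2 - m ^ 2)) \<and>
     dsum_converges 1 5 1 q q q \<and>
     dsum_converges 1 5 1 (q^4) (q^4) q \<and>
     (\<Sum>n. (-1) ^ n * q ^ (n * (n + 1) div 2) / qpoch q q n)
       = qpoch_inf (- q) q / qpoch_inf q q *
         (\<Sum>n. \<Sum>m\<in>{- int n..int n}. (-1) powi m * (1 - q ^ (2 * n + 1)) * q powi ((3 * int n ^ 2 + int n) div 2 - m ^ 2)) \<and>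
     qpoch_inf (- q) q / qpoch_inf q q *
         (\<Sum>n. \<Sum>m\<in>{- int n..int n}. (-1) powi m * (1 - q ^ (2 * n + 1)) * q powi ((3 * int n ^ 2 + int n) div 2 - m ^ 2))
       = qpoch_inf (- q) q / qpoch_inf q q * (dsum_f 1 5 1 q q q + q ^ 2 * dsum_f 1 5 1 (q^4) (q^4) q) \<and>
     qpoch_inf (- q) q / qpoch_inf q q * (dsum_f 1 5 1 q q q + q ^ 2 * dsum_f 1 5 1 (q^4) (q^4) q)
       = qpoch_inf (- q) q / qpoch_inf q q * eta_J 1 q * theta_J 1 2 q \<and>
     qpoch_inf (- q) q / qpoch_inf q q * eta_J 1 q * theta_J 1 2 q
       = eta_J 1 q)"
proof -
  have q: "norm q < 1" and q0: "q \<noteq> 0"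
    using assms by auto
  have q2: "norm (q ^ 2) < 1"
    using q by (simp add: norm_power power_less_one_iff)
  define P1 P2 V N where "P1 = qpoch_inf q q" and "P2 = qpoch_inf (q ^ 2) (q ^ 2)"
    and "V = qpoch_inf q (q ^ 2)" and "N = qpoch_inf (- q) q"
  have P1: "P1 \<noteq> 0" and P2: "P2 \<noteq> 0"
    unfolding P1_def P2_def by (rule qpoch_inf_nonzero power_mult_neq_one q q2)+
  have P1_V: "P1 = V * P2"
    using qpoch_inf_dissect[OF q, of 2 q]
    by (simp add: P1_def P2_def V_def eval_nat_numeral)
  have "P1 * N = P2"
    using qpoch_inf_mult_minus[OF q, of q] by (simp add: P1_def P2_def N_def)
  \<comment> \<open>Euler's identity \<open>(q; q\<^sup>2)\<^sub>\<infinity> (-q;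
    q)\<^sub>\<infinity> = 1\<close>.\<close>
  with P1_V P2 have V_N: "V * N = 1"
    by (simp add: mult_ac)
  have V: "V \<noteq> 0"
    using V_N by auto
  have J1: "eta_J 1 q = P1" and J2: "eta_J 2 q = P2"
    using eta_J_eq[OF q q0, of 1] eta_J_eq[OF q q0, of 2] by (simp_all add: P1_def P2_def)
  have J12: "theta_J 1 2 q = V ^ 2 * P2"
    using theta_J_1_2[OF q0] by (simp add: V_def P2_def)

  obtain S1 where S1: "(\<lambda>n. qpoch q (q ^ 2) n * q ^ n / qpoch (q ^ 2) (q ^ 2) n) sums (V / P2 * S1)"
    "(\<lambda>n. \<Sum>m\<in>{- int n..int n}. (-1) powi (int n + m) * q powi (int n ^ 2 + int n - m ^ 2)) sums S1"
    unfolding V_def P2_def by (rule bailey_sqrt[OF q q0])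
  have D1: "dsum_f 0 1 0 (- q) (- q) (q^4) = S1"
    using sums_unique2[OF hecke_double_sum_010(2)[OF q q0] S1(2)] .
  \<comment> \<open>The closed form comes from evaluating the single sum independently, not from the
    double sum.\<close>
  have E1: "V / P2 * S1 = P2 / V"
    using sums_unique2[OF S1(1) qbinomial_odd_sums[OF q q0]] by (simp add: V_def P2_def)
  have chain1: "P2 / V = P2 ^ 2 / P1"
    using P2 by (simp add: P1_V power2_eq_square)

  obtain S2 where S2: "(\<lambda>n. (-1) ^ n * q ^ (n ^ 2 + n) / qpoch (q ^ 2) (q ^ 2) n) sums (S2 / P1)"
    "(\<lambda>n. \<Sum>m\<in>{- int n..int n}. (-1) powi m * (1 - q ^ (2 * n + 1)) *
        q powi (2 * int n ^ 2 + int n - m ^ 2)) sums S2"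
    unfolding P1_def by (rule bailey_00[OF q q0])
  have D2: "dsum_f 1 3 1 (q^2) (q^2) (q^2) + q ^ 3 * dsum_f 1 3 1 (q^6) (q^6) (q^2) = S2"
    using sums_unique2[OF hecke_double_sum_131(3)[OF q q0] S2(2)] .
  \<comment> \<open>Identifies the summands with those of \<open>euler_sums\<close> in base
    \<open>q ^ 2\<close>.\<close>
  have "(q ^ 2) ^ (n * (n + 1) div 2) = q ^ (n ^ 2 + n)" for n
  proof -
    have "2 * (n * (n + 1) div 2) = n ^ 2 + n"
      by (simp add: power2_eq_square)
    then show ?thesis
      by (simp only: power_mult[symmetric])
  qed
  then have E2: "S2 / P1 = P2"
    using sums_unique2[OF S2(1)] euler_sums[OF q2] by (simp add: P2_def)

  obtain S3 where S3: "(\<lambda>n. (-1) ^ n * q ^ (n * (n + 1) div 2) / qpoch q q n) sums (N / P1 * S3)"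
    "(\<lambda>n. \<Sum>m\<in>{- int n..int n}. (-1) powi m * (1 - q ^ (2 * n + 1)) *
        q powi ((3 * int n ^ 2 + int n) div 2 - m ^ 2)) sums S3"
    unfolding N_def P1_def by (rule bailey_01[OF q q0])
  have D3: "dsum_f 1 5 1 q q q + q ^ 2 * dsum_f 1 5 1 (q^4) (q^4) q = S3"
    using sums_unique2[OF hecke_double_sum_151(3)[OF q q0] S3(2)] .
  have E3: "N / P1 * S3 = P1"
    using sums_unique2[OF S3(1) euler_sums[OF q]] by (simp add: P1_def)
  have "N / P1 * P1 * (V ^ 2 * P2) = V * N * (V * P2)"
    using P1 by (simp add: power2_eq_square)
  then have chain3: "N / P1 * P1 * (V ^ 2 * P2) = P1"
    by (simp add: V_N P1_V)

  \<comment> \<open>The convergence claims, which equations between \<open>suminf\<close> values do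
    not express, come from the \<open>sums\<close> facts and the \<open>dsum_converges\<close>
    parts.\<close>
  show ?thesis
    unfolding J1 J2 J12 D1 D2 D3 P1_def[symmetric] P2_def[symmetric] V_def[symmetric] N_def[symmetric]
      sums_unique[OF S1(1), symmetric] sums_unique[OF S1(2), symmetric]
      sums_unique[OF S2(1), symmetric] sums_unique[OF S2(2), symmetric]
      sums_unique[OF S3(1), symmetric] sums_unique[OF S3(2), symmetric]
    using sums_summable[OF S1(1)] sums_summable[OF S1(2)] sums_summable[OF S2(1)]
      sums_summable[OF S2(2)] sums_summable[OF S3(1)] sums_summable[OF S3(2)]
      hecke_double_sum_010(1)[OF q q0] hecke_double_sum_131(1,2)[OF q q0]
      hecke_double_sum_151(1,2)[OF q q0] E1 E2 E3 chain1 chain3 P1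
    by (intro conjI) simp_all
qed

end
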